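(* For every $\alpha\in(0,1)$ there exists $N$ such that the following holds. Let $\Phi$ be an effective infinite CNF over Boolean variables $x_0,x_1,\ldots$ such that for every $n$ each variable appears in at most $2^{\alpha n}$ clauses of size $n$, and all clauses have size at least $N$. Then $\Phi$ has a computable satisfying assignment.
   Context: Here a CNF is a conjunction of countably many clauses $C_0,C_1,\ldots$, each a disjunction of literals on finitely many distinct variables; the size of a clause is the number of its variables. The CNF is effective in the sense that given $j$ one can compute the clause $C_j$, and for each $i$ and each $n$ one can compute the (finite) list of clauses of size $n$ that contain the variable $x_i$. A variable may appear in infinitely many clauses in total. *)

theory Defs
  imports Complex_Main "HOL-Library.Nat_Bijection"
begin

section \<open>Partial recursive functions\<close>

text \<open>
  Kleene's $\mu$-recursive functions. Programs carry no arity: a program denotes a partial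
  function on argument lists of every length, and on lists of a fixed length \<open>k\<close> the
  denotable functions are exactly the \<open>k\<close>-ary partial recursive ones. The recursion
  argument of \<open>PrimRec\<close> and the search argument of \<open>Mu\<close> come first in the list.
\<close>

datatype prog =
    Zero
  | Succ
  | Proj nat
  | Comp prog "prog list"
  | PrimRec prog prog
  | Mu prog

primrec run :: "prog \<Rightarrow> nat list \<Rightarrow> nat option" where
  "run Zero xs = Some 0"
| "run Succ xs = (case xs of [] \<Rightarrow> None | x # _ \<Rightarrow> Some (Suc x))"
| "run (Proj i) xs = (if i < length xs then Some (xs ! i) else None)"
| "run (Comp f gs) xs = Option.bind (those (map (\<lambda>g. run g xs) gs)) (run f)"
| "run (PrimRec f g) xs =
     (case xs of [] \<Rightarrow> None
      | x # ys \<Rightarrow> rec_nat (run f ys) (\<lambda>k r. Option.bind r (\<lambda>v. run g (k # v # ys))) x)"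
| "run (Mu f) xs =
     (if \<exists>y. run f (y # xs) = Some 0 \<and> (\<forall>z<y. run f (z # xs) \<noteq> None)
      then Some (LEAST y. run f (y # xs) = Some 0)
      else None)"

definition computable1 :: "(nat \<Rightarrow> nat) \<Rightarrow> bool" where
  "computable1 f \<longleftrightarrow> (\<exists>p. \<forall>x. run p [x] = Some (f x))"

definition computable2 :: "(nat \<Rightarrow> nat \<Rightarrow> nat) \<Rightarrow> bool" where
  "computable2 f \<longleftrightarrow> (\<exists>p. \<forall>x y. run p [x, y] = Some (f x y))"


section \<open>Clauses and effective CNFs\<close>

text \<open>The literal \<open>(i, True)\<close> is $x_i$, and \<open>(i, False)\<close> is $\neg x_i$.\<close>

type_synonym lit = "nat \<times> bool"
type_synonym clause = "lit set"

text \<open>Injectivity of \<open>fst\<close> says that the literals are on distinct variables.\<close>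

definition is_clause :: "clause \<Rightarrow> bool" where
  "is_clause c \<longleftrightarrow> finite c \<and> inj_on fst c"

definition clause_vars :: "clause \<Rightarrow> nat set" where
  "clause_vars c = fst ` c"

definition clause_size :: "clause \<Rightarrow> nat" where
  "clause_size c = card (clause_vars c)"

definition satisfies_clause :: "(nat \<Rightarrow> bool) \<Rightarrow> clause \<Rightarrow> bool" where
  "satisfies_clause a c \<longleftrightarrow> (\<exists>(i, b)\<in>c. a i = b)"

definition satisfies_cnf :: "(nat \<Rightarrow> bool) \<Rightarrow> (nat \<Rightarrow> clause) \<Rightarrow> bool" where
  "satisfies_cnf a C \<longleftrightarrow> (\<forall>j. satisfies_clause a (C j))"

text \<open>
  The clauses of size \<open>n\<close> containing the variable $x_i$, as a set of clauses rather than of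
  indices: a clause that is repeated in the sequence \<open>C\<close> counts once.
\<close>

definition clauses_with :: "(nat \<Rightarrow> clause) \<Rightarrow> nat \<Rightarrow> nat \<Rightarrow> clause set" where
  "clauses_with C i n = {c \<in> range C. i \<in> clause_vars c \<and> clause_size c = n}"

definition lit_code :: "lit \<Rightarrow> nat" where
  "lit_code l = prod_encode (fst l, of_bool (snd l))"

text \<open>\<open>set_encode\<close> is injective on finite sets only; all uses below are on finite clauses.\<close>

definition clause_code :: "clause \<Rightarrow> nat" where
  "clause_code c = set_encode (lit_code ` c)"

text \<open>
  The lists \<open>L i n\<close> may come in any order and with repetitions. Their existence entails that
  each set \<open>clauses_with C i n\<close> is finite.
\<close>

definition effective_cnf :: "(nat \<Rightarrow> clause) \<Rightarrow> bool" where
  "effective_cnf C \<longleftrightarrow>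
     (\<forall>j. is_clause (C j)) \<and>
     computable1 (\<lambda>j. clause_code (C j)) \<and>
     (\<exists>L :: nat \<Rightarrow> nat \<Rightarrow> clause list.
        (\<forall>i n. set (L i n) = clauses_with C i n) \<and>
        computable2 (\<lambda>i n. list_encode (map clause_code (L i n))))"

definition computable_assignment :: "(nat \<Rightarrow> bool) \<Rightarrow> bool" where
  "computable_assignment a \<longleftrightarrow> computable1 (\<lambda>i. of_bool (a i))"

end

theory Submission
  imports Defs "HOL-Library.FuncSet"
begin

text \<open>
  The assignment is extracted from the Moser--Tardos algorithm run on a random table. The table is
  a number \<open>r\<close> whose bit \<open>prod_encode (v, k)\<close> is the value of the variable \<open>v\<close> after \<open>v\<close> has been
  resampled \<open>k\<close> times; at each step the first violated clause of a growing finite list is resampled.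

  The clauses that influenced a given resampling can be reordered, without changing the table
  entries they read, into a word built recursively: a clause preceded by at most one word for each of
  its literals. A word is compatible with a random table with probability \<open>2\<close> to the minus its total
  number of literals, and a branching-process estimate bounds the expected number of compatible heavy
  words at a variable. Hence, apart from a set of tables whose measure is controlled effectively, a
  variable is only resampled on account of small clauses close to it, so its final value is reached by
  a computable time. The probability that the final values start with a given
  bit string is therefore computable by counting tables, and choosing each bit so as to keep
  that probability positive yields a computable satisfying assignment.
\<close>

subsection \<open>Closure properties of computable functions\<close>

text \<open>Argument lists of fixed length stand for tuples, so composition, projection and
  recursion need one rule for all arities.\<close>

definition computableN :: "nat \<Rightarrow> (nat list \<Rightarrow> nat) \<Rightarrow> bool" where
  "computableN n f \<longleftrightarrow> (\<exists>p. \<forall>xs. length xs = n \<longrightarrow> run p xs = Some (f xs))"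

lemma computableN_comp1:
  assumes "computable1 f" "computableN n g"
  shows "computableN n (\<lambda>xs. f (g xs))"
proof -
  obtain p q where p: "\<And>x. run p [x] = Some (f x)"
    and q: "\<And>xs. length xs = n \<Longrightarrow> run q xs = Some (g xs)"
    using assms unfolding computableN_def computable1_def by metis
  show ?thesis
    unfolding computableN_def by (rule exI[of _ "Comp p [q]"]) (simp add: p q)
qed

lemma computableN_comp2:
  assumes "computable2 f" "computableN n g" "computableN n h"
  shows "computableN n (\<lambda>xs. f (g xs) (h xs))"
proof -
  obtain p q r where p: "\<And>x y. run p [x, y] = Some (f x y)"
    and q: "\<And>xs. length xs = n \<Longrightarrow> run q xs = Some (g xs)"
    and r: "\<And>xs. length xs = n \<Longrightarrow> run r xs = Some (h xs)"
    using assms unfolding computableN_def computable2_def by metis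
  show ?thesis
    unfolding computableN_def by (rule exI[of _ "Comp p [q, r]"]) (simp add: p q r)
qed

lemma computable1_Suc: "computable1 Suc"
  unfolding computable1_def by (rule exI[of _ Succ]) simp

lemma computableN_proj: "i < n \<Longrightarrow> computableN n (\<lambda>xs. xs ! i)"
  unfolding computableN_def by (rule exI[of _ "Proj i"]) simp

lemma computableN_const: "computableN n (\<lambda>xs. c)"
proof (induction c)
  case 0
  show ?case unfolding computableN_def by (rule exI[of _ Zero]) simp
next
  case (Suc c)
  from computableN_comp1[OF computable1_Suc Suc] show ?case .
qed

lemma computableN_PrimRec:
  assumes "computableN n a" "computableN (Suc (Suc n)) g"
  shows "computableN (Suc n) (\<lambda>xs. rec_nat (a (tl xs)) (\<lambda>k v. g (k # v # tl xs)) (hd xs))"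
proof -
  obtain p q where p: "\<And>xs. length xs = n \<Longrightarrow> run p xs = Some (a xs)"
    and q: "\<And>xs. length xs = Suc (Suc n) \<Longrightarrow> run q xs = Some (g xs)"
    using assms unfolding computableN_def by metis
  have "run (PrimRec p q) (x # ys) = Some (rec_nat (a ys) (\<lambda>k v. g (k # v # ys)) x)"
    if "length ys = n" for x ys
    by (induction x) (simp_all add: p q that)
  then show ?thesis
    unfolding computableN_def by (intro exI[of _ "PrimRec p q"]) (auto simp: length_Suc_conv)
qed

lemma all_lists_length_1: "(\<forall>xs. length xs = Suc 0 \<longrightarrow> P xs) \<longleftrightarrow> (\<forall>x. P [x])"
  by (auto simp: length_Suc_conv)

lemma all_lists_length_2: "(\<forall>xs. length xs = Suc (Suc 0) \<longrightarrow> P xs) \<longleftrightarrow> (\<forall>x y. P [x, y])"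
  by (auto simp: length_Suc_conv)

lemma computable1_iff_computableN: "computable1 f \<longleftrightarrow> computableN 1 (\<lambda>xs. f (xs ! 0))"
  by (simp add: computable1_def computableN_def all_lists_length_1)

lemma computable2_iff_computableN: "computable2 f \<longleftrightarrow> computableN 2 (\<lambda>xs. f (xs ! 0) (xs ! 1))"
  by (simp add: computable2_def computableN_def all_lists_length_2 numeral_2_eq_2)

lemma computable1_rec:
  assumes "computable2 g"
  shows "computable1 (rec_nat c g)"
proof -
  have "computableN (Suc (Suc 0)) (\<lambda>xs. g (xs ! 0) (xs ! 1))"
    using assms by (simp only: computable2_iff_computableN numeral_2_eq_2)
  from computableN_PrimRec[OF computableN_const this] show ?thesis
    by (simp add: computable1_def computableN_def all_lists_length_1)
qed

lemma computable2_rec: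
  assumes "computable1 a" "computable2 g"
  shows "computable2 (\<lambda>x y. rec_nat (a y) (\<lambda>k v. g k v) x)"
proof -
  have "computableN (Suc 0) (\<lambda>xs. a (xs ! 0))"
    using assms(1) by (simp only: computable1_iff_computableN One_nat_def)
  moreover have "computableN (Suc (Suc (Suc 0))) (\<lambda>xs. g (xs ! 0) (xs ! 1))"
    by (rule computableN_comp2[OF assms(2)]) (auto intro: computableN_proj)
  ultimately show ?thesis
    using computableN_PrimRec[of "Suc 0" "\<lambda>xs. a (xs ! 0)" "\<lambda>xs. g (xs ! 0) (xs ! 1)"]
    by (simp add: computable2_def computableN_def all_lists_length_2)
qed

lemma computable2_add: "computable2 (+)"
proof -
  have "computable2 (\<lambda>x y. rec_nat y (\<lambda>k v. Suc v) x)"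
    unfolding computable1_iff_computableN computable2_iff_computableN
    by (rule computable2_rec[unfolded computable1_iff_computableN computable2_iff_computableN])
      (intro computableN_comp1[OF computable1_Suc] computableN_proj; simp)+
  moreover have "rec_nat y (\<lambda>k v. Suc v) x = x + y" for x y :: nat
    by (induction x) auto
  ultimately show ?thesis by (simp add: computable2_def)
qed

lemma computable1_pred: "computable1 (\<lambda>x. x - 1)"
proof -
  have "computable1 (rec_nat 0 (\<lambda>k v. k))"
    by (rule computable1_rec) (auto simp: computable2_iff_computableN intro: computableN_proj)
  moreover have "rec_nat 0 (\<lambda>k v. k) = (\<lambda>x::nat. x - 1)"
  proof
    show "rec_nat 0 (\<lambda>k v. k) x = x - 1" for x :: nat by (cases x) auto
  qed
  ultimately show ?thesis by simp
qed

lemma computable2_diff: "computable2 (-)"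
proof -
  \<comment> \<open>Recursion runs on the first argument, so the subtrahend comes first here; the
    arguments are swapped afterwards.\<close>
  have "computable2 (\<lambda>x y. rec_nat y (\<lambda>k v. v - 1) x)"
    unfolding computable1_iff_computableN computable2_iff_computableN
    by (rule computable2_rec[unfolded computable1_iff_computableN computable2_iff_computableN])
      (intro computableN_comp1[OF computable1_pred] computableN_proj; simp)+
  moreover have "rec_nat y (\<lambda>k v. v - 1) x = y - x" for x y :: nat
    by (induction x) auto
  ultimately have "computable2 (\<lambda>x y. y - x)" by (simp add: computable2_def)
  then have "computableN 2 (\<lambda>xs. (xs ! 0) - (xs ! 1))"
    by (rule computableN_comp2) (auto intro: computableN_proj)
  then show ?thesis by (simp add: computable2_iff_computableN)
qed

lemma computable1_triangle: "computable1 triangle"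
proof -
  have "computable1 (rec_nat 0 (\<lambda>k v. v + Suc k))"
    by (rule computable1_rec)
      (auto simp: computable2_iff_computableN
        intro!: computableN_comp2[OF computable2_add] computableN_comp1[OF computable1_Suc] computableN_proj simp del: add_Suc_right)
  moreover have "rec_nat 0 (\<lambda>k v. v + Suc k) = triangle"
  proof
    show "rec_nat 0 (\<lambda>k v. v + Suc k) x = triangle x" for x by (induction x) auto
  qed
  ultimately show ?thesis by simp
qed

lemma computable2_prod_encode: "computable2 (\<lambda>x y. prod_encode (x, y))"
  unfolding prod_encode_def computable2_iff_computableN
  by (simp, intro computableN_comp2[OF computable2_add] computableN_comp1[OF computable1_triangle] computableN_proj) auto

lemma computable_prod_decode:
  "computable1 (\<lambda>x. fst (prod_decode x))" "computable1 (\<lambda>x. snd (prod_decode x))"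
proof -
  \<comment> \<open>\<open>d z\<close> is the index of the diagonal containing \<open>z\<close>, that is, the sum of the two components.\<close>
  define d where "d = rec_nat 0 (\<lambda>k v. v + (1 - (triangle (Suc v) - Suc k)))"
  have comp_d: "computable1 d"
    unfolding d_def
    by (rule computable1_rec)
      (auto simp: computable2_iff_computableN simp del: triangle_Suc
        intro!: computableN_comp2[OF computable2_add] computableN_comp2[OF computable2_diff]
          computableN_comp1[OF computable1_triangle] computableN_comp1[OF computable1_Suc] computableN_proj computableN_const)
  have d: "triangle (d z) \<le> z \<and> z < triangle (Suc (d z))" for z
  proof (induction z)
    case (Suc z)
    \<comment> \<open>By truncation the increment is \<open>1\<close> exactly when
      \<open>Suc z\<close> has reached the start of the next diagonal.\<close>
    have step: "d (Suc z) = d z + (1 - (triangle (Suc (d z)) - Suc z))" by (simp add: d_def)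
    show ?case
    proof (cases "triangle (Suc (d z)) \<le> Suc z")
      case True
      with Suc have "d (Suc z) = Suc (d z)" "triangle (Suc (d z)) = Suc z" using step by auto
      then show ?thesis by simp
    next
      case False
      with step have "d (Suc z) = d z" by simp
      with Suc False show ?thesis by simp
    qed
  qed (simp add: d_def)
  have dec: "prod_decode z = (z - triangle (d z), d z - (z - triangle (d z)))" for z
  proof -
    have "prod_encode (z - triangle (d z), d z - (z - triangle (d z))) = z"
      using d[of z] by (auto simp: prod_encode_def)
    then show ?thesis by (metis prod_encode_inverse)
  qed
  have m: "computableN 1 (\<lambda>xs. (xs ! 0) - triangle (d (xs ! 0)))"
    by (intro computableN_comp2[OF computable2_diff] computableN_comp1[OF computable1_triangle] computableN_comp1[OF comp_d] computableN_proj)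
      auto
  then show "computable1 (\<lambda>x. fst (prod_decode x))"
    by (simp add: dec computable1_iff_computableN)
  have "computableN 1 (\<lambda>xs. d (xs ! 0) - ((xs ! 0) - triangle (d (xs ! 0))))"
    by (intro computableN_comp2[OF computable2_diff] m computableN_comp1[OF comp_d] computableN_proj) auto
  then show "computable1 (\<lambda>x. snd (prod_decode x))"
    by (simp add: dec computable1_iff_computableN)
qed

subsection \<open>Computable functions between encoded types\<close>

text \<open>One injective numbering per type lets computability be proved by rules that follow the
  structure of a term; injectivity is what makes equality decidable on codes.\<close>

class enc =
  fixes enc :: "'a \<Rightarrow> nat"
  assumes enc_inj: "enc x = enc y \<Longrightarrow> x = y"

instantiation nat :: enc
begin
definition "enc (n::nat) = n"
instance by standard (simp add: enc_nat_def)
end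

instantiation bool :: enc
begin
definition "enc (b::bool) = of_bool b"
instance by standard (simp add: enc_bool_def of_bool_def split: if_splits)
end

instantiation prod :: (enc, enc) enc
begin
definition "enc p = prod_encode (enc (fst p), enc (snd p))"
instance by standard (auto simp: enc_prod_def prod_eq_iff dest: enc_inj)
end

instantiation list :: (enc) enc
begin
definition "enc xs = list_encode (map enc xs)"
instance
  by standard (auto simp: enc_list_def list_encode_eq dest!: map_injective intro: injI enc_inj)
end

text \<open>Functions of several arguments are treated as functions on nested pairs. This is why the
  rules below speak about bound variables through \<open>fst\<close> and \<open>snd\<close>.\<close>

definition cmp :: "('a::enc \<Rightarrow> 'b::enc) \<Rightarrow> bool" where
  "cmp f \<longleftrightarrow> (\<exists>p. \<forall>x. run p [enc x] = Some (enc (f x)))"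

named_theorems cmp_intros

lemma cmp_transfer: "cmp f \<Longrightarrow> (\<And>x. enc (g x) = enc (f x)) \<Longrightarrow> cmp g"
  by (simp add: cmp_def)

lemma cmp_code:
  assumes "computable1 F" "\<And>x. enc (f x) = F (enc x)"
  shows "cmp f"
  using assms unfolding cmp_def computable1_def by auto

lemma cmp_nat_iff: "cmp (f :: nat \<Rightarrow> nat) \<longleftrightarrow> computable1 f"
  by (simp add: cmp_def computable1_def enc_nat_def)

lemma cmp_comp:
  assumes "cmp f" "cmp g"
  shows "cmp (\<lambda>x. f (g x))"
proof -
  obtain p q where "\<And>x. run p [enc x] = Some (enc (f x))" "\<And>x. run q [enc x] = Some (enc (g x))"
    using assms unfolding cmp_def by metis
  then show ?thesis
    unfolding cmp_def by (intro exI[of _ "Comp p [q]"]) simp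
qed

lemma cmp_code2:
  assumes "computable2 F" "cmp f" "cmp g" "\<And>x. enc (h x) = F (enc (f x)) (enc (g x))"
  shows "cmp h"
proof -
  obtain p q r where "\<And>x y. run r [x, y] = Some (F x y)"
    "\<And>x. run p [enc x] = Some (enc (f x))" "\<And>x. run q [enc x] = Some (enc (g x))"
    using assms(1-3) unfolding cmp_def computable2_def by metis
  then show ?thesis
    unfolding cmp_def using assms(4) by (intro exI[of _ "Comp r [p, q]"]) simp
qed

lemma cmp_pair[cmp_intros]: "cmp f \<Longrightarrow> cmp g \<Longrightarrow> cmp (\<lambda>x. (f x, g x))"
  by (rule cmp_code2[OF computable2_prod_encode], assumption, assumption) (simp add: enc_prod_def)

lemma cmp_id[cmp_intros]: "cmp (\<lambda>x. x)"
  by (rule cmp_code[of "\<lambda>x. x"]) (auto simp: computable1_iff_computableN computableN_proj)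

lemma cmp_const[cmp_intros]: "cmp (\<lambda>x. c)"
  by (rule cmp_code[of "\<lambda>_. enc c"]) (auto simp: computable1_iff_computableN computableN_const)

lemma cmp_fst[cmp_intros]: "cmp f \<Longrightarrow> cmp (\<lambda>x. fst (f x))"
  by (rule cmp_comp[of fst], rule cmp_code[OF computable_prod_decode(1)]) (simp_all add: enc_prod_def)

lemma cmp_snd[cmp_intros]: "cmp f \<Longrightarrow> cmp (\<lambda>x. snd (f x))"
  by (rule cmp_comp[of snd], rule cmp_code[OF computable_prod_decode(2)]) (simp_all add: enc_prod_def)

lemma cmp2:
  assumes "cmp (\<lambda>p. F (fst p) (snd p))" "cmp f" "cmp g"
  shows "cmp (\<lambda>x. F (f x) (g x))"
  using cmp_comp[OF assms(1) cmp_pair[OF assms(2,3)]] by simp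

lemma cmp3:
  assumes "cmp (\<lambda>p. F (fst p) (fst (snd p)) (snd (snd p)))" "cmp f" "cmp g" "cmp h"
  shows "cmp (\<lambda>x. F (f x) (g x) (h x))"
  using cmp_comp[OF assms(1) cmp_pair[OF assms(2) cmp_pair[OF assms(3,4)]]] by simp

lemma cmp_rec_nat[cmp_intros]:
  assumes "cmp a" "cmp (\<lambda>p. g (fst p) (fst (snd p)) (snd (snd p)))" "cmp n"
  shows "cmp (\<lambda>x. rec_nat (a x) (g x) (n x))"
proof -
  obtain p q r where p: "\<And>x. run p [enc x] = Some (enc (a x))"
    and q: "\<And>x k v. run q [prod_encode (enc x, prod_encode (k, enc v))] = Some (enc (g x k v))"
    and r: "\<And>x. run r [enc x] = Some (n x)"
    using assms unfolding cmp_def by (fastforce simp: enc_prod_def enc_nat_def)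
  obtain pe where pe: "\<And>x y. run pe [x, y] = Some (prod_encode (x, y))"
    using computable2_prod_encode unfolding computable2_def by metis
  \<comment> \<open>\<open>PrimRec\<close> supplies counter, value and parameter in this order; they
    are repacked as the code of \<open>(x, (k, v))\<close>.\<close>
  define h where "h = PrimRec p (Comp q [Comp pe [Proj 2, Comp pe [Proj 0, Proj 1]]])"
  have "run h [m, enc x] = Some (enc (rec_nat (a x) (g x) m))" for m x
    by (induction m) (simp_all add: h_def p q pe)
  then show ?thesis
    unfolding cmp_def by (intro exI[of _ "Comp h [r, Proj 0]"]) (simp add: r)
qed

section \<open>Arithmetic, case distinctions and comparisons on codes\<close>

lemma cmp_Suc[cmp_intros]: "cmp f \<Longrightarrow> cmp (\<lambda>x. Suc (f x))"
  by (rule cmp_comp[of Suc]) (auto simp: cmp_nat_iff computable1_Suc)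

lemma cmp_add[cmp_intros]: "cmp f \<Longrightarrow> cmp g \<Longrightarrow> cmp (\<lambda>x. f x + (g x :: nat))"
  by (rule cmp_code2[OF computable2_add], assumption, assumption) (simp add: enc_nat_def)

lemma cmp_diff[cmp_intros]: "cmp f \<Longrightarrow> cmp g \<Longrightarrow> cmp (\<lambda>x. f x - (g x :: nat))"
  by (rule cmp_code2[OF computable2_diff], assumption, assumption) (simp add: enc_nat_def)

lemma cmp_enc: "cmp f \<Longrightarrow> cmp (\<lambda>x. enc (f x))"
  by (erule cmp_transfer) (simp add: enc_nat_def)

lemma cmp_if[cmp_intros]:
  assumes "cmp b" "cmp f" "cmp g"
  shows "cmp (\<lambda>x. if b x then f x else g x)"
proof -
  \<comment> \<open>The truth value, coded \<open>0\<close> or \<open>1\<close>, is the number of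
    recursion steps: none leaves \<open>g x\<close>, one produces \<open>f x\<close>.\<close>
  have "cmp (\<lambda>x. rec_nat (g x) (\<lambda>_ _. f x) (enc (b x)))"
    by (intro cmp_intros assms cmp_comp[OF assms(2)] cmp_enc)
  then show ?thesis by (rule cmp_transfer) (simp add: enc_bool_def)
qed

lemma cmp_eq[cmp_intros]:
  assumes "cmp f" "cmp g"
  shows "cmp (\<lambda>x. f x = g x)"
proof -
  \<comment> \<open>Two codes coincide iff both truncated differences vanish.\<close>
  have "cmp (\<lambda>x. 1 - ((enc (f x) - enc (g x)) + (enc (g x) - enc (f x))))"
    by (intro cmp_intros cmp_enc assms)
  moreover have "enc (a = b) = enc (1 - ((enc a - enc b) + (enc b - enc a)))" for a b :: 'b
    using enc_inj[of a b] by (cases "enc a = enc b") (auto simp: enc_bool_def enc_nat_def)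
  ultimately show ?thesis by (rule cmp_transfer)
qed

lemma cmp_not[cmp_intros]: "cmp b \<Longrightarrow> cmp (\<lambda>x. \<not> b x)"
  by (rule cmp_transfer[of "\<lambda>x. if b x then False else True"]) (intro cmp_intros | simp add: enc_bool_def)+

lemma cmp_le[cmp_intros]: "cmp f \<Longrightarrow> cmp g \<Longrightarrow> cmp (\<lambda>x. f x \<le> (g x :: nat))"
  by (rule cmp_transfer[of "\<lambda>x. f x - g x = 0"]) (intro cmp_intros | simp add: enc_bool_def)+

lemma cmp_mult[cmp_intros]:
  assumes "cmp f" "cmp g"
  shows "cmp (\<lambda>x. f x * (g x :: nat))"
proof -
  have eq: "rec_nat 0 (\<lambda>k v. v + n) m = m * n" for m n :: nat by (induction m) auto
  have "cmp (\<lambda>x. rec_nat 0 (\<lambda>k v. v + g x) (f x))"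
    by (intro cmp_intros assms cmp_comp[OF assms(2)])
  then show ?thesis by (simp add: eq)
qed

lemma cmp_power[cmp_intros]:
  assumes "cmp f" "cmp g"
  shows "cmp (\<lambda>x. f x ^ g x :: nat)"
proof -
  have eq: "rec_nat 1 (\<lambda>k v. v * n) m = n ^ m" for m n :: nat by (induction m) auto
  have "cmp (\<lambda>x. rec_nat 1 (\<lambda>k v. v * f x) (g x))"
    by (intro cmp_intros assms cmp_comp[OF assms(1)])
  then show ?thesis by (simp only: eq)
qed

lemma cmp_prod_encode[cmp_intros]: "cmp f \<Longrightarrow> cmp (\<lambda>x. prod_encode (f x))"
  by (erule cmp_transfer) (simp add: enc_nat_def enc_prod_def)

lemma cmp_prod_decode[cmp_intros]: "cmp f \<Longrightarrow> cmp (\<lambda>x. prod_decode (f x))"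
  by (erule cmp_transfer) (simp add: enc_nat_def enc_prod_def)

section \<open>List operations and binary digits\<close>

lemma cmp_Cons[cmp_intros]:
  assumes "cmp f" "cmp g"
  shows "cmp (\<lambda>x. f x # g x)"
proof -
  have "cmp (\<lambda>x. Suc (prod_encode (enc (f x), enc (g x))))"
    by (intro cmp_intros cmp_enc assms)
  then show ?thesis by (rule cmp_transfer) (simp add: enc_nat_def enc_list_def)
qed

lemma cmp_tl[cmp_intros]:
  assumes "cmp f"
  shows "cmp (\<lambda>x. tl (f x))"
proof -
  have "cmp (\<lambda>x. snd (prod_decode (enc (f x) - 1)))"
    by (intro cmp_intros cmp_enc assms)
  \<comment> \<open>The code of \<open>[]\<close> is \<open>0\<close>, its truncated predecessor is
    again \<open>0\<close>, and this decodes to a pair with second component \<open>0\<close>, in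
    agreement with \<open>tl [] = []\<close>.\<close>
  moreover have "prod_decode 0 = (0, 0)"
    by (simp add: prod_decode_def prod_decode_aux.simps)
  then have "enc (tl l) = snd (prod_decode (enc l - 1))" for l :: "'b list"
    by (cases l) (simp_all add: enc_list_def)
  ultimately show ?thesis by (auto intro: cmp_transfer simp: enc_nat_def)
qed

lemma cmp_hd[cmp_intros]:
  assumes "cmp f"
  shows "cmp (\<lambda>x. hd (f x))"
proof -
  \<comment> \<open>\<open>hd []\<close> is unspecified but fixed, so its code enters as a
    constant.\<close>
  have "cmp (\<lambda>x. if f x = [] then enc (hd [] :: 'b) else fst (prod_decode (enc (f x) - 1)))"
    by (intro cmp_intros cmp_enc assms)
  moreover have "enc (hd l) = (if l = [] then enc (hd [] :: 'b) else fst (prod_decode (enc l - 1)))"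
    for l :: "'b list"
    by (cases l) (simp_all add: enc_list_def)
  ultimately show ?thesis by (auto intro: cmp_transfer simp: enc_nat_def)
qed

text \<open>Every \<open>Cons\<close> raises the code by at least one. Hence the code itself is a
  computable bound on the length of a loop over the list.\<close>

lemma length_le_enc: "length xs \<le> enc xs"
proof (induction xs)
  case (Cons x xs)
  then show ?case
    using le_prod_encode_2[of "enc xs" "enc x"] by (simp add: enc_list_def)
qed simp

text \<open>The state stands still once the list is used up, so any number of iterations from the
  length on gives the same result.\<close>

lemma rec_nat_foldl:
  "length xs \<le> n \<Longrightarrow> rec_nat (a, xs)
     (\<lambda>_ v. if snd v = [] then v else (f (fst v) (hd (snd v)), tl (snd v))) n = (foldl f a xs, [])"
proof -
  have "rec_nat (a, xs) (\<lambda>_ v. if snd v = [] then v else (f (fst v) (hd (snd v)), tl (snd v))) n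
     = (foldl f a (take n xs), drop n xs)"
  proof (induction n)
    case (Suc n)
    then show ?case
      by (cases "n < length xs") (auto simp: take_Suc_conv_app_nth hd_drop_conv_nth tl_drop drop_Suc)
  qed simp
  then show "length xs \<le> n \<Longrightarrow> ?thesis" by simp
qed

lemma cmp_foldl[cmp_intros]:
  assumes "cmp (\<lambda>p. f (fst p) (fst (snd p)) (snd (snd p)))" "cmp a" "cmp l"
  shows "cmp (\<lambda>x. foldl (f x) (a x) (l x))"
proof -
  have "cmp (\<lambda>x. fst (rec_nat (a x, l x) (\<lambda>_ v. if snd v = [] then v
      else (f x (fst v) (hd (snd v)), tl (snd v))) (enc (l x))))"
    by (intro cmp_intros cmp_enc cmp3[OF assms(1)] assms(2,3))
  then show ?thesis by (simp add: rec_nat_foldl length_le_enc)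
qed

lemma cmp_rev[cmp_intros]:
  assumes "cmp l"
  shows "cmp (\<lambda>x. rev (l x))"
proof -
  have "cmp (\<lambda>x. foldl (\<lambda>ys y. y # ys) [] (l x))" by (intro cmp_intros assms)
  moreover have "foldl (\<lambda>ys y. y # ys) zs xs = rev xs @ zs" for xs zs :: "'b list"
    by (induction xs arbitrary: zs) auto
  ultimately show ?thesis by simp
qed

lemma cmp_append[cmp_intros]:
  assumes "cmp l" "cmp m"
  shows "cmp (\<lambda>x. l x @ m x)"
proof -
  have "cmp (\<lambda>x. foldl (\<lambda>ys y. y # ys) (m x) (rev (l x)))" by (intro cmp_intros assms)
  moreover have "foldl (\<lambda>ys y. y # ys) zs xs = rev xs @ zs" for xs zs :: "'b list"
    by (induction xs arbitrary: zs) auto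
  ultimately show ?thesis by simp
qed

lemma cmp_map[cmp_intros]:
  assumes "cmp (\<lambda>p. f (fst p) (snd p))" "cmp l"
  shows "cmp (\<lambda>x. map (f x) (l x))"
proof -
  have "cmp (\<lambda>x. foldl (\<lambda>ys y. ys @ [f x y]) [] (l x))" by (intro cmp_intros assms(2) cmp2[OF assms(1)])
  moreover have "foldl (\<lambda>ys y. ys @ [g y]) zs xs = zs @ map g xs" for g :: "'b \<Rightarrow> 'c" and xs zs
    by (induction xs arbitrary: zs) auto
  ultimately show ?thesis by simp
qed

lemma cmp_filter[cmp_intros]:
  assumes "cmp (\<lambda>p. P (fst p) (snd p))" "cmp l"
  shows "cmp (\<lambda>x. filter (P x) (l x))"
proof -
  have "cmp (\<lambda>x. foldl (\<lambda>ys y. if P x y then ys @ [y] else ys) [] (l x))"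
    by (intro cmp_intros assms(2) cmp2[OF assms(1)])
  moreover have "foldl (\<lambda>ys y. if Q y then ys @ [y] else ys) zs xs = zs @ filter Q xs"
    for Q :: "'b \<Rightarrow> bool" and xs zs
    by (induction xs arbitrary: zs) auto
  ultimately show ?thesis by simp
qed

lemma cmp_concat[cmp_intros]:
  assumes "cmp l"
  shows "cmp (\<lambda>x. concat (l x))"
proof -
  have "cmp (\<lambda>x. foldl (\<lambda>ys y. ys @ y) [] (l x))" by (intro cmp_intros assms)
  moreover have "foldl (\<lambda>ys y. ys @ y) zs xs = zs @ concat xs" for zs and xs :: "'b list list"
    by (induction xs arbitrary: zs) auto
  ultimately show ?thesis by simp
qed

lemma cmp_length[cmp_intros]:
  assumes "cmp l"
  shows "cmp (\<lambda>x. length (l x))"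
proof -
  have "cmp (\<lambda>x. foldl (\<lambda>n y. Suc n) 0 (l x))" by (intro cmp_intros assms)
  moreover have "foldl (\<lambda>n y. Suc n) k xs = k + length xs" for k and xs :: "'b list"
    by (induction xs arbitrary: k) auto
  ultimately show ?thesis by simp
qed

lemma cmp_sum_list[cmp_intros]:
  assumes "cmp l"
  shows "cmp (\<lambda>x. sum_list (l x) :: nat)"
proof -
  have "cmp (\<lambda>x. foldl (\<lambda>n y. n + y) 0 (l x))" by (intro cmp_intros assms)
  then show ?thesis by (simp add: fold_plus_sum_list_rev foldl_conv_fold add.commute)
qed

lemma cmp_list_all[cmp_intros]:
  assumes "cmp (\<lambda>p. P (fst p) (snd p))" "cmp l"
  shows "cmp (\<lambda>x. list_all (P x) (l x))"
proof -
  have "cmp (\<lambda>x. filter (\<lambda>y. \<not> P x y) (l x) = [])" by (intro cmp_intros assms(2) cmp2[OF assms(1)])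
  then show ?thesis by (simp add: filter_empty_conv list_all_iff)
qed

lemma cmp_member[cmp_intros]:
  assumes "cmp f" "cmp l"
  shows "cmp (\<lambda>x. f x \<in> set (l x))"
proof -
  have "cmp (\<lambda>x. \<not> list_all (\<lambda>y. y \<noteq> f x) (l x))" by (intro cmp_intros assms cmp_comp[OF assms(1)])
  moreover have "\<not> list_all (\<lambda>y. y \<noteq> z) xs \<longleftrightarrow> z \<in> set xs" for z :: 'b and xs
    by (auto simp: list_all_iff)
  ultimately show ?thesis by simp
qed

lemma cmp_upt[cmp_intros]:
  assumes "cmp n"
  shows "cmp (\<lambda>x. [0..<n x])"
proof -
  have "cmp (\<lambda>x. rec_nat [] (\<lambda>k v. v @ [k]) (n x))" by (intro cmp_intros assms)
  moreover have "rec_nat [] (\<lambda>k v. v @ [k]) m = [0..<m]" for m by (induction m) auto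
  ultimately show ?thesis by simp
qed

lemma cmp_bit[cmp_intros]:
  assumes "cmp f" "cmp g"
  shows "cmp (\<lambda>x. bit (f x :: nat) (g x))"
proof -
  \<comment> \<open>Halving is expressed by counting, since only addition, comparison and filtering
    are available so far; a bit is then the parity after repeated halving.\<close>
  have half: "length (filter (\<lambda>i. 2 * Suc i \<le> n) [0..<n]) = n div 2" for n :: nat
  proof -
    have "length (filter (\<lambda>i. 2 * Suc i \<le> n) [0..<n]) = card {i. i < n \<and> 2 * Suc i \<le> n}"
      by (subst length_filter_conv_card) (auto intro: arg_cong[where f = card])
    also have "{i. i < n \<and> 2 * Suc i \<le> n} = {..<n div 2}" by auto
    finally show ?thesis by simp
  qed
  have halves: "rec_nat m (\<lambda>_ v. length (filter (\<lambda>i. 2 * Suc i \<le> v) [0..<v])) k = m div 2 ^ k"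
    for m k :: nat
    by (induction k) (simp_all only: half, simp_all add: div_mult2_eq[symmetric] mult.commute)
  have "cmp (\<lambda>x. rec_nat (f x) (\<lambda>_ v. length (filter (\<lambda>i. 2 * Suc i \<le> v) [0..<v])) (g x))"
    by (intro cmp_intros assms)
  then have quot: "cmp (\<lambda>x. f x div 2 ^ g x)" by (simp only: halves)
  have "cmp (\<lambda>n. \<not> n = 2 * length (filter (\<lambda>i. 2 * Suc i \<le> n) [0..<n]))"
    by (intro cmp_intros)
  then have "cmp (\<lambda>n::nat. odd n)"
    by (rule cmp_transfer) (rule arg_cong[where f = enc], simp only: half, presburger)
  from cmp_comp[OF this quot] show ?thesis by (simp add: bit_iff_odd)
qed

subsection \<open>Words and histories\<close>

type_synonym lclause = "(nat \<times> bool) list"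

abbreviation vars :: "lclause \<Rightarrow> nat set" where
  "vars c \<equiv> fst ` set c"

definition weight :: "lclause list \<Rightarrow> nat" where
  "weight w = sum_list (map length w)"

lemma weight_simps[simp]: "weight [] = 0" "weight (c # w) = length c + weight w"
  "weight (v @ w) = weight v + weight w"
  by (simp_all add: weight_def)

definition cats :: "'a list set list \<Rightarrow> 'a list set" where
  "cats As = foldr (\<lambda>A B. (\<lambda>(u, v). u @ v) ` (A \<times> B)) As {[]}"

lemma cats_simps[simp]: "cats [] = {[]}" "cats (A # As) = (\<lambda>(u, v). u @ v) ` (A \<times> cats As)"
  by (simp_all add: cats_def)

text \<open>Linearised witness trees of the Moser--Tardos analysis, of depth at most
  \<open>h\<close>, with the root clause last. Words are never empty, so \<open>[]\<close> can mark
  a literal without a subtree.\<close>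

primrec Words :: "lclause set \<Rightarrow> nat \<Rightarrow> nat \<Rightarrow> lclause list set" where
  "Words F 0 v = {}"
| "Words F (Suc h) v = (\<Union>c\<in>{c \<in> F. v \<in> vars c}.
     (\<lambda>w. w @ [c]) ` cats (map (\<lambda>l. insert [] (Words F h (fst l))) c))"

lemma finite_cats: "(\<And>A. A \<in> set As \<Longrightarrow> finite A) \<Longrightarrow> finite (cats As)"
  by (induction As) auto

lemma finite_Words: "finite F \<Longrightarrow> finite (Words F h v)"
  by (induction h arbitrary: v) (auto intro!: finite_UN_I finite_imageI finite_cats)

text \<open>Weights add under concatenation, so the sum over pairs factorises; pairs with the same
  concatenation only make the left side smaller.\<close>

lemma sum_cats_le:
  fixes \<rho> :: real
  assumes "\<rho> \<ge> 0" "\<And>A. A \<in> set As \<Longrightarrow> finite A \<and> (\<Sum>w\<in>A. \<rho> ^ weight w) \<le> z"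
  shows "(\<Sum>w\<in>cats As. \<rho> ^ weight w) \<le> z ^ length As"
  using assms(2)
proof (induction As)
  case (Cons A As)
  have fin: "finite A" "finite (cats As)"
    using Cons.prems by (auto intro!: finite_cats)
  have "(\<Sum>w\<in>cats (A # As). \<rho> ^ weight w) \<le> (\<Sum>p\<in>A \<times> cats As. \<rho> ^ weight (fst p @ snd p))"
    using sum_image_le[of "A \<times> cats As" "\<lambda>w. \<rho> ^ weight w" "\<lambda>(u, v). u @ v"] fin assms(1)
    by (simp add: case_prod_beta o_def)
  also have "\<dots> = (\<Sum>w\<in>A. \<rho> ^ weight w) * (\<Sum>w\<in>cats As. \<rho> ^ weight w)"
    by (simp add: sum_product sum.cartesian_product power_add case_prod_beta)
  also have "\<dots> \<le> z * z ^ length As"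
  proof (rule mult_mono)
    show "(\<Sum>w\<in>A. \<rho> ^ weight w) \<le> z" using Cons.prems by simp
    moreover have "0 \<le> (\<Sum>w\<in>A. \<rho> ^ weight w)" using assms(1) by (intro sum_nonneg) simp
    ultimately show "0 \<le> z" by simp
    show "(\<Sum>w\<in>cats As. \<rho> ^ weight w) \<le> z ^ length As"
      by (rule Cons.IH) (use Cons.prems in simp)
    show "0 \<le> (\<Sum>w\<in>cats As. \<rho> ^ weight w)" using assms(1) by (intro sum_nonneg) simp
  qed
  finally show ?case by simp
qed simp

lemma sum_UN_le:
  fixes f :: "'b \<Rightarrow> real"
  assumes "finite I" "\<And>i. i \<in> I \<Longrightarrow> finite (A i)" "\<And>x. f x \<ge> 0"
  shows "sum f (\<Union>i\<in>I. A i) \<le> (\<Sum>i\<in>I. sum f (A i))"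
  using assms(1,2)
proof (induction I)
  case (insert i I)
  have "sum f (\<Union>i\<in>insert i I. A i) \<le> sum f (A i) + sum f (\<Union>i\<in>I. A i)"
    using sum.union_inter[of "A i" "\<Union>i\<in>I. A i" f] sum_nonneg[of "A i \<inter> (\<Union>i\<in>I. A i)" f]
      insert.prems insert.hyps assms(3) by auto
  then show ?case using insert by (simp add: insert.hyps)
qed simp

text \<open>
  Each literal of a clause carries an optional word, which contributes a factor \<open>1 + y\<close> when the
  total weight of the words at every variable is at most \<open>y\<close>.
\<close>

lemma sum_Words_le:
  fixes \<rho> y :: real
  assumes "finite F" "\<rho> \<ge> 0" "y \<ge> 0"
    and branch: "\<And>v. (\<Sum>c\<in>{c \<in> F. v \<in> vars c}. (\<rho> * (1 + y)) ^ length c) \<le> y"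
  shows "(\<Sum>w\<in>Words F h v. \<rho> ^ weight w) \<le> y"
proof (induction h arbitrary: v)
  case 0
  then show ?case using assms by simp
next
  case (Suc h)
  let ?A = "\<lambda>c. cats (map (\<lambda>l. insert [] (Words F h (fst l))) c)"
  have fin: "finite (?A c)" for c
    using assms(1) by (auto intro!: finite_cats finite_Words)
  have one: "(\<Sum>w\<in>insert [] (Words F h u). \<rho> ^ weight w) \<le> 1 + y" for u
    using Suc[of u] assms by (simp add: sum.insert_if finite_Words)
  have "(\<Sum>w\<in>Words F (Suc h) v. \<rho> ^ weight w)
      \<le> (\<Sum>c\<in>{c \<in> F. v \<in> vars c}. \<Sum>w\<in>(\<lambda>w. w @ [c]) ` ?A c. \<rho> ^ weight w)"
    using assms(1,2) fin by (simp only: Words.simps, intro sum_UN_le) auto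
  also have "\<dots> \<le> (\<Sum>c\<in>{c \<in> F. v \<in> vars c}. (\<rho> * (1 + y)) ^ length c)"
  proof (rule sum_mono)
    fix c
    have "(\<Sum>w\<in>(\<lambda>w. w @ [c]) ` ?A c. \<rho> ^ weight w) = (\<Sum>w\<in>?A c. \<rho> ^ weight w) * \<rho> ^ length c"
      by (subst sum.reindex) (auto simp: inj_on_def power_add sum_distrib_right)
    also have "(\<Sum>w\<in>?A c. \<rho> ^ weight w) * \<rho> ^ length c \<le>
        (1 + y) ^ length (map (\<lambda>l. insert [] (Words F h (fst l))) c) * \<rho> ^ length c"
    proof (rule mult_right_mono)
      show "(\<Sum>w\<in>?A c. \<rho> ^ weight w) \<le> (1 + y) ^ length (map (\<lambda>l. insert [] (Words F h (fst l))) c)"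
      proof (rule sum_cats_le[OF assms(2)])
        fix A assume "A \<in> set (map (\<lambda>l. insert [] (Words F h (fst l))) c)"
        then obtain u where "A = insert [] (Words F h u)" by auto
        then show "finite A \<and> (\<Sum>w\<in>A. \<rho> ^ weight w) \<le> 1 + y"
          using one[of u] finite_Words[OF assms(1)] by simp
      qed
    qed (use assms(2) in simp)
    finally show "(\<Sum>w\<in>(\<lambda>w. w @ [c]) ` ?A c. \<rho> ^ weight w) \<le> (\<rho> * (1 + y)) ^ length c"
      by (simp add: power_mult_distrib mult.commute)
  qed
  also have "\<dots> \<le> y" by (rule branch)
  finally show ?case .
qed

text \<open>
  Here \<open>d\<close> maps each time to the clause resampled at that time, with \<open>[]\<close> for an idle step. A history
  is a set of times closed under the earlier times sharing a variable, listed in any order that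
  respects these dependencies.
\<close>

definition dep :: "(nat \<Rightarrow> lclause) \<Rightarrow> nat \<Rightarrow> nat \<Rightarrow> bool" where
  "dep d s t \<longleftrightarrow> s < t \<and> vars (d s) \<inter> vars (d t) \<noteq> {}"

definition history :: "(nat \<Rightarrow> lclause) \<Rightarrow> nat set \<Rightarrow> nat list \<Rightarrow> bool" where
  "history d A ts \<longleftrightarrow> distinct ts \<and> set ts \<subseteq> A \<and>
     (\<forall>s\<in>A. \<forall>t\<in>set ts. dep d s t \<longrightarrow> s \<in> set ts) \<and> sorted_wrt (\<lambda>s t. \<not> dep d t s) ts"

text \<open>As \<open>ts\<close> is closed under dependencies, nothing in \<open>us\<close> can
  influence an element of \<open>ts\<close>; so \<open>us\<close> may be placed after it.\<close>

lemma history_append: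
  assumes "history d A ts" "history d (A - set ts) us"
  shows "history d A (ts @ us)"
  unfolding history_def
proof (intro conjI ballI impI)
  show "distinct (ts @ us)" "set (ts @ us) \<subseteq> A"
    using assms by (auto simp: history_def)
  show "sorted_wrt (\<lambda>s t. \<not> dep d t s) (ts @ us)"
    using assms unfolding history_def sorted_wrt_append by (intro conjI ballI) auto
  fix s t assume "s \<in> A" "t \<in> set (ts @ us)" "dep d s t"
  then show "s \<in> set (ts @ us)"
    using assms by (cases "s \<in> set ts") (auto simp: history_def)
qed

text \<open>The literals are handled one after another: a single history collects all remaining
  times that touch the variable of the literal, these times are removed, and the next literal is
  served from what is left.\<close>

lemma history_in_cats:
  assumes IH: "\<And>A' t v. finite A' \<Longrightarrow> A' \<subseteq> A \<Longrightarrow> t \<in> A' \<Longrightarrow> v \<in> vars (d t) \<Longrightarrow>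
      \<exists>ts. history d A' ts \<and> t \<in> set ts \<and> map d ts \<in> Words F h v"
    and "finite A'" "A' \<subseteq> A"
  shows "\<exists>ts. history d A' ts \<and> (\<forall>s\<in>A'. vars (d s) \<inter> vars c \<noteq> {} \<longrightarrow> s \<in> set ts) \<and>
      map d ts \<in> cats (map (\<lambda>l. insert [] (Words F h (fst l))) c)"
  using assms(2,3)
proof (induction c arbitrary: A')
  case Nil
  show ?case by (rule exI[of _ "[]"]) (simp add: history_def)
next
  case (Cons l c)
  obtain ts where ts: "history d A' ts" "\<And>s. s \<in> A' \<Longrightarrow> fst l \<in> vars (d s) \<Longrightarrow> s \<in> set ts"
    "map d ts \<in> insert [] (Words F h (fst l))"
  proof (cases "\<exists>s\<in>A'. fst l \<in> vars (d s)")
    case False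
    then show ?thesis by (intro that[of "[]"]) (auto simp: history_def)
  next
    case True
    \<comment> \<open>Times touching the same variable depend on one another, so the history of the
      last one contains them all.\<close>
    define B where "B = {s \<in> A'. fst l \<in> vars (d s)}"
    have B: "finite B" "B \<noteq> {}" using True Cons.prems by (auto simp: B_def)
    then have Max: "Max B \<in> A'" "fst l \<in> vars (d (Max B))" using Max_in[OF B] by (auto simp: B_def)
    from IH[OF Cons.prems this] obtain ts
      where ts: "history d A' ts" "Max B \<in> set ts" "map d ts \<in> Words F h (fst l)" by blast
    have "s \<in> set ts" if "s \<in> A'" "fst l \<in> vars (d s)" for s
    proof (cases "s = Max B")
      case False
      have "s \<le> Max B" using that B by (auto simp: B_def)
      then have "dep d s (Max B)" using False that Max by (auto simp: dep_def)
      then show ?thesis using ts(1,2) that(1) by (auto simp: history_def)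
    qed (use ts in simp)
    then show ?thesis using that ts by blast
  qed
  obtain us where us: "history d (A' - set ts) us"
    "\<And>s. s \<in> A' - set ts \<Longrightarrow> vars (d s) \<inter> vars c \<noteq> {} \<Longrightarrow> s \<in> set us"
    "map d us \<in> cats (map (\<lambda>l. insert [] (Words F h (fst l))) c)"
    using Cons.IH[of "A' - set ts"] Cons.prems by blast
  have "history d A' (ts @ us)" by (rule history_append[OF ts(1) us(1)])
  moreover have "s \<in> set (ts @ us)" if "s \<in> A'" "vars (d s) \<inter> vars (l # c) \<noteq> {}" for s
    using ts(2)[of s] us(2)[of s] that by auto
  moreover have "map d (ts @ us) \<in> cats (map (\<lambda>l. insert [] (Words F h (fst l))) (l # c))"
    using ts(3) us(3) by force
  ultimately show ?case by blast
qed

text \<open>The clause at \<open>t\<close> becomes the root, and the times before \<open>t\<close>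
  are distributed over its literals. Each level discards at least \<open>t\<close>, so the
  cardinality of \<open>A\<close> bounds the depth.\<close>

lemma history_in_Words:
  assumes "finite A" "card A \<le> h" "t \<in> A" "v \<in> vars (d t)" "\<And>s. s \<in> A \<Longrightarrow> d s \<in> F \<or> d s = []"
  shows "\<exists>ts. history d A ts \<and> t \<in> set ts \<and> map d ts \<in> Words F h v"
  using assms
proof (induction h arbitrary: A t v)
  case (Suc h)
  define A' where "A' = {s \<in> A. s < t}"
  have A': "finite A'" "A' \<subseteq> A" "card A' \<le> h"
  proof -
    have "A' \<subset> A" using Suc.prems by (auto simp: A'_def)
    then have "card A' < card A" using Suc.prems by (intro psubset_card_mono)
    then show "card A' \<le> h" using Suc.prems by simp
  qed (use Suc.prems in \<open>auto simp: A'_def\<close>)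
  have "\<exists>ts. history d A'' ts \<and> t' \<in> set ts \<and> map d ts \<in> Words F h v'"
    if "finite A''" "A'' \<subseteq> A'" "t' \<in> A''" "v' \<in> vars (d t')" for A'' t' v'
  proof (rule Suc.IH)
    show "card A'' \<le> h" using card_mono[OF A'(1) that(2)] A'(3) by simp
  qed (use that A' Suc.prems(5) in auto)
  from history_in_cats[OF this A'(1) order_refl, of "d t"] obtain ts
    where ts: "history d A' ts" "\<And>s. s \<in> A' \<Longrightarrow> vars (d s) \<inter> vars (d t) \<noteq> {} \<Longrightarrow> s \<in> set ts"
      "map d ts \<in> cats (map (\<lambda>l. insert [] (Words F h (fst l))) (d t))"
    by blast
  have lt: "s < t" if "s \<in> set ts" for s
    using ts(1) that by (auto simp: history_def A'_def)
  have "history d A (ts @ [t])"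
    unfolding history_def
  proof (intro conjI ballI impI)
    show "distinct (ts @ [t])" using ts(1) lt by (auto simp: history_def)
    show "set (ts @ [t]) \<subseteq> A" using ts(1) A'(2) Suc.prems by (auto simp: history_def)
    show "sorted_wrt (\<lambda>s t. \<not> dep d t s) (ts @ [t])"
      using ts(1) lt by (force simp: history_def sorted_wrt_append dep_def)
    fix s t' assume st: "s \<in> A" "t' \<in> set (ts @ [t])" "dep d s t'"
    then have "s < t" using lt by (force simp: dep_def)
    then have "s \<in> A'" using st(1) by (simp add: A'_def)
    moreover have "vars (d s) \<inter> vars (d t') \<noteq> {}" using st(3) by (simp add: dep_def)
    ultimately have "s \<in> set ts"
      using st(2,3) ts(2)[of s] ts(1) unfolding history_def by (cases "t' = t") auto
    then show "s \<in> set (ts @ [t])" by simp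
  qed
  moreover have "map d (ts @ [t]) \<in> Words F (Suc h) v"
  proof -
    have "d t \<in> F" "v \<in> vars (d t)" using Suc.prems(3,4) Suc.prems(5)[of t] by auto
    then show ?thesis using ts(3) by auto
  qed
  ultimately show ?case by (metis in_set_conv_decomp)
qed simp

subsection \<open>Resampling on a table\<close>

lemma triangle_mono: "a \<le> b \<Longrightarrow> triangle a \<le> triangle b"
  unfolding triangle_def by (intro div_le_mono mult_le_mono) auto

lemma prod_encode_mono: "a \<le> a' \<Longrightarrow> b \<le> b' \<Longrightarrow> prod_encode (a, b) \<le> prod_encode (a', b')"
  by (simp add: prod_encode_def add_mono triangle_mono)

text \<open>With this, \<open>prod_encode (V, t) \<le> L\<close> expresses that \<open>L\<close>
  table bits cover the variables below \<open>V\<close> through their first \<open>t\<close>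
  resamplings.\<close>

lemma prod_encode_strict_mono: "a < a' \<Longrightarrow> b \<le> b' \<Longrightarrow> prod_encode (a, b) < prod_encode (a', b')"
  using triangle_mono[of "a + b" "a' + b'"] by (simp add: prod_encode_def)

definition cnt :: "nat \<Rightarrow> lclause list \<Rightarrow> nat" where
  "cnt v w = length (filter (\<lambda>c. v \<in> set (map fst c)) w)"

definition val :: "nat \<Rightarrow> lclause list \<Rightarrow> nat \<Rightarrow> bool" where
  "val r w v = bit r (prod_encode (v, cnt v w))"

definition viol :: "nat \<Rightarrow> lclause list \<Rightarrow> lclause \<Rightarrow> bool" where
  "viol r w c = list_all (\<lambda>l. val r w (fst l) \<noteq> snd l) c"

text \<open>The word is replayed on its own, without the rest of the run; this is the table check of
  Moser and Tardos.\<close>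

definition consistent :: "nat \<Rightarrow> lclause list \<Rightarrow> bool" where
  "consistent r w \<longleftrightarrow> (\<forall>j<length w. viol r (take j w) (w ! j))"

lemma cnt_simps[simp]: "cnt v [] = 0" "cnt v (c # w) = (if v \<in> vars c then Suc (cnt v w) else cnt v w)"
  "cnt v (w @ w') = cnt v w + cnt v w'"
  by (simp_all add: cnt_def)

lemma cnt_le_length: "cnt v w \<le> length w"
  by (simp add: cnt_def)

section \<open>Counting the tables consistent with a word\<close>

lemma weight_eq_sum: "weight w = (\<Sum>j<length w. length (w ! j))"
  by (simp add: weight_def sum_list_sum_nth atLeast0LessThan)

text \<open>With the bits at \<open>Z\<close> fixed, a table in \<open>S\<close> is determined by
  its remaining \<open>L - card Z\<close> bits.\<close>

lemma card_tables_le: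
  fixes Z S :: "nat set"
  assumes "Z \<subseteq> {..<L}" "\<And>r r' z. r \<in> S \<Longrightarrow> r' \<in> S \<Longrightarrow> z \<in> Z \<Longrightarrow> bit r z = bit r' z" "S \<subseteq> {..<2 ^ L}"
  shows "card S * 2 ^ card Z \<le> 2 ^ L"
proof -
  let ?f = "\<lambda>r::nat. {z \<in> {..<L} - Z. bit r z}"
  have inj: "inj_on ?f S"
  proof (rule inj_onI, rule bit_eqI)
    fix r r' :: nat and z assume S: "r \<in> S" "r' \<in> S" and eq: "?f r = ?f r'"
    then have lt: "take_bit L r = r" "take_bit L r' = r'"
      using assms(3) by (auto intro!: take_bit_nat_eq_self)
    show "bit r z = bit r' z"
    proof (cases "z < L")
      case True
      then show ?thesis using eq assms(2)[OF S, of z] by (cases "z \<in> Z") auto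
    next
      case False
      then show ?thesis using lt by (metis bit_take_bit_iff)
    qed
  qed
  have "card S \<le> card (Pow ({..<L} - Z))"
    by (rule card_inj_on_le[OF inj]) auto
  also have "\<dots> = 2 ^ (L - card Z)"
    using assms(1) by (simp add: card_Pow card_Diff_subset finite_subset)
  finally have "card S * 2 ^ card Z \<le> 2 ^ (L - card Z) * 2 ^ card Z" by simp
  also have "\<dots> = 2 ^ L"
    using card_mono[OF _ assms(1)] by (simp flip: power_add)
  finally show ?thesis .
qed

text \<open>Every literal occurrence forces the bit it reads to be the opposite of the literal. No
  bit is read twice, because an occurrence of a variable advances its counter; thus
  \<open>weight w\<close> distinct bits are prescribed.\<close>

lemma card_consistent_le:
  assumes "\<And>c. c \<in> set w \<Longrightarrow> distinct (map fst c)" "\<And>c v. c \<in> set w \<Longrightarrow> v \<in> vars c \<Longrightarrow> v < V"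
    and "prod_encode (V, length w) \<le> L"
  shows "card {r. r < 2 ^ L \<and> consistent r w} * 2 ^ weight w \<le> 2 ^ L"
proof -
  let ?D = "SIGMA j:{..<length w}. vars (w ! j)"
  let ?f = "\<lambda>(j, v). prod_encode (v, cnt v (take j w))"
  have less: "cnt v (take j w) < cnt v (take j' w)" if "j < j'" "j < length w" "v \<in> vars (w ! j)" for j j' v
  proof -
    have "take j' w = take j w @ [w ! j] @ drop (Suc j) (take j' w)"
      using that
      by (metis Suc_leI append.assoc append_take_drop_id min.absorb1 take_Suc_conv_app_nth take_take)
    then have "cnt v (take j' w) = cnt v (take j w @ [w ! j] @ drop (Suc j) (take j' w))" by simp
    then show ?thesis using that by simp
  qed
  have inj: "inj_on ?f ?D"
  proof (rule inj_onI)
    fix p p' assume p: "p \<in> ?D" "p' \<in> ?D" "?f p = ?f p'"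
    obtain j v j' v' where jv: "p = (j, v)" "p' = (j', v')" by fastforce
    then have "v' = v" "cnt v (take j w) = cnt v (take j' w)" using p(3) by auto
    then show "p = p'"
      using less[of j j' v] less[of j' j v] p(1,2) jv by (cases j j' rule: linorder_cases) auto
  qed
  have "card ?D = (\<Sum>j<length w. card (vars (w ! j)))" by simp
  also have "\<dots> = (\<Sum>j<length w. length (w ! j))"
    using assms(1) by (intro sum.cong refl) (metis distinct_card length_map lessThan_iff nth_mem set_map)
  also have "\<dots> = weight w" by (simp add: weight_eq_sum)
  finally have cardZ: "card (?f ` ?D) = weight w" using inj by (simp add: card_image)
  have "card {r. r < 2 ^ L \<and> consistent r w} * 2 ^ card (?f ` ?D) \<le> 2 ^ L"
  proof (rule card_tables_le)
    have "prod_encode (v, cnt v (take j w)) < L" if "j < length w" "v \<in> vars (w ! j)" for j v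
    proof -
      have "v < V" using that assms(2) nth_mem by blast
      moreover have "cnt v (take j w) \<le> length w"
        using cnt_le_length[of v "take j w"] that by simp
      ultimately show ?thesis using prod_encode_strict_mono assms(3) by (meson less_le_trans)
    qed
    then show "?f ` ?D \<subseteq> {..<L}" by auto
  next
    fix r r' z assume r: "r \<in> {r. r < 2 ^ L \<and> consistent r w}" "r' \<in> {r. r < 2 ^ L \<and> consistent r w}"
      and "z \<in> ?f ` ?D"
    then obtain j l where jl: "j < length w" "l \<in> set (w ! j)" "z = prod_encode (fst l, cnt (fst l) (take j w))"
      by auto
    then have "bit r z \<noteq> snd l" "bit r' z \<noteq> snd l"
      using r by (auto simp: consistent_def viol_def list_all_iff val_def)
    then show "bit r z = bit r' z" by blast
  qed auto
  then show ?thesis by (simp add: cardZ)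
qed

lemma cats_member:
  assumes "w \<in> cats As" "e \<in> set w"
  shows "\<exists>A\<in>set As. \<exists>p\<in>A. e \<in> set p \<and> length p \<le> length w \<and> weight p \<le> weight w"
  using assms
proof (induction As arbitrary: w)
  case (Cons A As)
  then obtain p w' where w: "w = p @ w'" "p \<in> A" "w' \<in> cats As" by auto
  show ?case
  proof (cases "e \<in> set p")
    case False
    then have "e \<in> set w'" using Cons.prems w by simp
    from Cons.IH[OF w(3) this] show ?thesis using w by (auto intro: trans_le_add2)
  qed (use w in auto)
qed simp

lemma Words_subset: "w \<in> Words F h v \<Longrightarrow> set w \<subseteq> F"
proof (induction h arbitrary: w v)
  case (Suc h)
  then obtain c w' where c: "c \<in> F" "w = w' @ [c]"
    "w' \<in> cats (map (\<lambda>l. insert [] (Words F h (fst l))) c)" by auto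
  have "set w' \<subseteq> F"
  proof
    fix e assume e: "e \<in> set w'"
    from cats_member[OF c(3) e] obtain u p where "p \<in> Words F h u" "e \<in> set p" by auto
    then show "e \<in> F" using Suc.IH by blast
  qed
  then show ?case using c by simp
qed simp

lemma length_le_weight: "e \<in> set w \<Longrightarrow> length e \<le> weight w"
  by (induction w) auto

lemma length_word_le_weight: "(\<And>e. e \<in> set w \<Longrightarrow> e \<noteq> []) \<Longrightarrow> length w \<le> weight w"
proof (induction w)
  case (Cons e w)
  then show ?case by (cases e) (auto simp: trans_le_add2)
qed simp

text \<open>\<open>B i n\<close> plays the role of the list of size \<open>n\<close> clauses at
  variable \<open>i\<close>. By \<open>B_closed\<close> the very same literal list is found from
  each of its variables, which lets clauses be located locally.\<close>

locale clause_system =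
  fixes B :: "nat \<Rightarrow> nat \<Rightarrow> lclause list"
  assumes B_member: "c \<in> set (B i n) \<Longrightarrow> i \<in> vars c \<and> length c = n \<and> distinct (map fst c)"
    and B_closed: "c \<in> set (B i n) \<Longrightarrow> u \<in> vars c \<Longrightarrow> c \<in> set (B u n)"
begin

section \<open>The resampling algorithm and its histories\<close>

definition clist :: "nat \<Rightarrow> lclause list" where
  "clist t = concat (map (\<lambda>j. B (fst (prod_decode j)) (snd (prod_decode j))) [0..<t])"

text \<open>The appended \<open>[]\<close> is the default when nothing is violated. Having no
  variables, it advances no counter, and it never occurs in \<open>clist t\<close>.\<close>

definition pick :: "nat \<Rightarrow> nat \<Rightarrow> lclause list \<Rightarrow> lclause" where
  "pick r t w = hd (filter (viol r w) (clist t) @ [[]])"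

text \<open>The newest entry stands first, unlike in words; \<open>cnt\<close> is insensitive to the
  order.\<close>

definition log :: "nat \<Rightarrow> nat \<Rightarrow> lclause list" where
  "log r t = rec_nat [] (\<lambda>t w. pick r t w # w) t"

definition resampled :: "nat \<Rightarrow> nat \<Rightarrow> lclause" where
  "resampled r t = pick r t (log r t)"

text \<open>A sum in place of a maximum: a crude computable number above every variable of
  \<open>clist t\<close>.\<close>

definition bound :: "nat \<Rightarrow> nat" where
  "bound t = sum_list (map (\<lambda>c. sum_list (map (\<lambda>l. Suc (fst l)) c)) (clist t))"

lemma log_simps[simp]: "log r 0 = []" "log r (Suc t) = resampled r t # log r t"
  by (simp_all add: log_def resampled_def)

lemma clist_member_iff: "c \<in> set (clist t) \<longleftrightarrow> (\<exists>i n. prod_encode (i, n) < t \<and> c \<in> set (B i n))"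
proof
  assume "c \<in> set (clist t)"
  then obtain j where "j < t" "c \<in> set (B (fst (prod_decode j)) (snd (prod_decode j)))"
    by (auto simp: clist_def)
  moreover have "prod_encode (fst (prod_decode j), snd (prod_decode j)) = j" by simp
  ultimately show "\<exists>i n. prod_encode (i, n) < t \<and> c \<in> set (B i n)" by metis
next
  assume "\<exists>i n. prod_encode (i, n) < t \<and> c \<in> set (B i n)"
  then obtain i n where "prod_encode (i, n) < t" "c \<in> set (B i n)" by blast
  then show "c \<in> set (clist t)"
    unfolding clist_def by (force intro!: bexI[of _ "prod_encode (i, n)"])
qed

lemma clist_member: "c \<in> set (clist t) \<Longrightarrow> c \<noteq> [] \<and> distinct (map fst c)"
  unfolding clist_member_iff using B_member by force

lemma clist_prefix: "s \<le> t \<Longrightarrow> \<exists>cs. clist t = clist s @ cs"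
  using upt_add_eq_append[of 0 s "t - s"] by (simp add: clist_def)

lemma clist_mono: "s \<le> t \<Longrightarrow> set (clist s) \<subseteq> set (clist t)"
  using clist_prefix by fastforce

lemma bound_mono: "s \<le> t \<Longrightarrow> bound s \<le> bound t"
  using clist_prefix[of s t] by (auto simp: bound_def)

lemma less_bound:
  assumes "c \<in> set (clist t)" "v \<in> vars c"
  shows "v < bound t"
proof -
  obtain l where l: "l \<in> set c" "v = fst l" using assms(2) by auto
  have "Suc (fst l) \<le> sum_list (map (\<lambda>l. Suc (fst l)) c)"
    using l(1) by (intro member_le_sum_list) auto
  also have "\<dots> \<le> bound t"
    unfolding bound_def using assms(1) by (intro member_le_sum_list) auto
  finally show ?thesis using l by simp
qed

lemma resampled_cases:
  "resampled r t = [] \<or> (resampled r t \<in> set (clist t) \<and> viol r (log r t) (resampled r t))"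
proof (cases "filter (viol r (log r t)) (clist t)")
  case (Cons c cs)
  then have "resampled r t = c" by (simp add: resampled_def pick_def)
  moreover have "c \<in> set (filter (viol r (log r t)) (clist t))" by (simp add: Cons)
  ultimately show ?thesis by auto
qed (simp add: resampled_def pick_def)

text \<open>\<open>clist s\<close> is a prefix of \<open>clist t\<close> and the first violated
  clause is picked, so a violation in the prefix takes precedence.\<close>

lemma resampled_priority:
  assumes "s \<le> t" "c \<in> set (clist s)" "viol r (log r t) c"
  shows "resampled r t \<in> set (clist s)"
proof -
  obtain cs where cs: "clist t = clist s @ cs" using clist_prefix[OF assms(1)] by blast
  have "filter (viol r (log r t)) (clist s) \<noteq> []" using assms by (auto simp: filter_empty_conv)
  then have "resampled r t = hd (filter (viol r (log r t)) (clist s))"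
    by (simp add: resampled_def pick_def cs)
  then show ?thesis
    using hd_in_set[OF \<open>filter (viol r (log r t)) (clist s) \<noteq> []\<close>] by auto
qed

lemma cnt_log: "cnt v (log r t) = card {s. s < t \<and> v \<in> vars (resampled r s)}"
proof (induction t)
  case (Suc t)
  have "{s. s < Suc t \<and> v \<in> vars (resampled r s)} = {s. s < t \<and> v \<in> vars (resampled r s)} \<union>
      (if v \<in> vars (resampled r t) then {t} else {})"
    by (auto simp: less_Suc_eq)
  then show ?case using Suc by simp
qed simp

lemma cnt_log_eq:
  assumes "s \<le> t" "\<And>u. s \<le> u \<Longrightarrow> u < t \<Longrightarrow> v \<notin> vars (resampled r u)"
  shows "cnt v (log r t) = cnt v (log r s)"
  using assms by (induction rule: dec_induct) auto

text \<open>For a variable \<open>v\<close> of the clause at time \<open>s\<close>, the earlier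
  times touching \<open>v\<close> all belong to the history by closure, and they are exactly the
  entries touching \<open>v\<close> that precede \<open>s\<close> in the list. So the replay reads
  the same table bit as the run did, and the clause was violated then.\<close>

lemma history_consistent:
  assumes "history (resampled r) {..t} ts"
  shows "consistent r (map (resampled r) ts)"
  unfolding consistent_def viol_def list_all_iff
proof (intro allI impI ballI)
  fix j l assume j: "j < length (map (resampled r) ts)" and "l \<in> set (map (resampled r) ts ! j)"
  define s where "s = ts ! j"
  define v where "v = fst l"
  have l: "l \<in> set (resampled r s)" using j \<open>l \<in> _\<close> by (simp add: s_def)
  then have v: "v \<in> vars (resampled r s)" by (simp add: v_def)
  have s: "s \<in> set ts" using j by (simp add: s_def)
  have ts: "distinct ts" "set ts \<subseteq> {..t}" "sorted_wrt (\<lambda>a b. \<not> dep (resampled r) b a) ts"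
    "\<And>a b. a \<le> t \<Longrightarrow> b \<in> set ts \<Longrightarrow> dep (resampled r) a b \<Longrightarrow> a \<in> set ts"
    using assms by (auto simp: history_def)
  have ordered: "\<not> dep (resampled r) (ts ! b) (ts ! a)" if "a < b" "b < length ts" for a b
    using ts(3) that by (auto simp: sorted_wrt_iff_nth_less)
  have image: "{s'. s' < s \<and> v \<in> vars (resampled r s')}
      = (!) ts ` {i. i < j \<and> v \<in> vars (resampled r (ts ! i))}" (is "?L = _ ` ?R")
  proof (intro set_eqI iffI)
    fix s' assume "s' \<in> ?L"
    then have s': "s' < s" "v \<in> vars (resampled r s')" by auto
    then have dep: "dep (resampled r) s' s" using v by (auto simp: dep_def)
    then have "s' \<in> set ts" using ts(4)[OF _ s] s' ts(2) s by fastforce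
    then obtain i where i: "i < length ts" "s' = ts ! i" by (metis in_set_conv_nth)
    have "i < j"
      using ordered[of j i] dep i s'(1) by (cases i j rule: linorder_cases) (auto simp: s_def)
    then show "s' \<in> (!) ts ` ?R" using i s'(2) by auto
  next
    fix s' assume "s' \<in> (!) ts ` ?R"
    then obtain i where i: "i < j" "s' = ts ! i" "v \<in> vars (resampled r s')" by auto
    have "s' \<noteq> s" using i j ts(1) by (auto simp: s_def nth_eq_iff_index_eq)
    moreover have "\<not> s < s'"
      using ordered[of i j] i j v by (auto simp: dep_def s_def)
    ultimately show "s' \<in> ?L" using i(3) by simp
  qed
  have "cnt v (take j (map (resampled r) ts)) = card ?R"
    using j by (simp add: cnt_def length_filter_conv_card)
      (rule arg_cong[where f = card], auto simp: image_iff)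
  also have "\<dots> = card ?L"
    unfolding image using ts(1) j
    by (intro card_image[symmetric]) (auto simp: inj_on_def nth_eq_iff_index_eq)
  also have "\<dots> = cnt v (log r s)" by (simp add: cnt_log)
  finally have cnt: "cnt v (take j (map (resampled r) ts)) = cnt v (log r s)" .
  have "viol r (log r s) (resampled r s)" using resampled_cases[of r s] l by auto
  then have "val r (log r s) (fst l) \<noteq> snd l" using l by (auto simp: viol_def list_all_iff)
  then show "val r (take j (map (resampled r) ts)) (fst l) \<noteq> snd l"
    using cnt by (simp add: val_def v_def)
qed

section \<open>Tables with heavy words, quiet moments and stability\<close>

definition bad :: "nat \<Rightarrow> nat \<Rightarrow> nat \<Rightarrow> nat \<Rightarrow> bool" where
  "bad H K v r \<longleftrightarrow> (\<exists>w\<in>Words (set (clist H)) H v. length w \<le> H \<and> K \<le> weight w \<and> consistent r w)"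

text \<open>The cut-offs at \<open>H\<close> in \<open>bad\<close> keep the event finite. They
  exclude no history of a time \<open>t < H\<close>, because only the at most \<open>H\<close> times
  up to \<open>t\<close> can occur in it.\<close>

lemma obtain_history:
  assumes "t < H" "v \<in> vars (resampled r t)"
  obtains ts where "history (resampled r) {..t} ts" "t \<in> set ts" "length ts \<le> H"
    "map (resampled r) ts \<in> Words (set (clist H)) H v" "consistent r (map (resampled r) ts)"
proof -
  have "\<exists>ts. history (resampled r) {..t} ts \<and> t \<in> set ts \<and> map (resampled r) ts \<in> Words (set (clist H)) H v"
  proof (rule history_in_Words)
    fix s assume "s \<in> {..t}"
    then have "set (clist s) \<subseteq> set (clist H)" using assms by (intro clist_mono) simp
    then show "resampled r s \<in> set (clist H) \<or> resampled r s = []"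
      using resampled_cases[of r s] by auto
  qed (use assms in auto)
  then obtain ts where ts: "history (resampled r) {..t} ts" "t \<in> set ts"
    "map (resampled r) ts \<in> Words (set (clist H)) H v" by blast
  have "length ts = card (set ts)" "set ts \<subseteq> {..t}"
    using ts(1) by (auto simp: history_def distinct_card)
  then have "length ts \<le> H" using card_mono[of "{..t}" "set ts"] assms(1) by simp
  then show ?thesis using that ts history_consistent[OF ts(1)] by blast
qed

text \<open>The history of the last resampling of \<open>v\<close> contains all earlier ones, and
  each nonempty clause adds at least one to the weight.\<close>

lemma frequent_bad:
  assumes "R > 0" "R \<le> card {s. s < t \<and> v \<in> vars (resampled r s)}" "t \<le> H"
  shows "bad H R v r"
proof -
  let ?S = "{s. s < t \<and> v \<in> vars (resampled r s)}"
  have S: "finite ?S" "?S \<noteq> {}" using assms(1,2) by (simp, metis card.empty not_le)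
  define m where "m = Max ?S"
  have m: "m \<in> ?S" using Max_in[OF S] by (simp add: m_def)
  then have mH: "m < H" "v \<in> vars (resampled r m)" using assms(3) by auto
  obtain ts where ts: "history (resampled r) {..m} ts" "m \<in> set ts" "length ts \<le> H"
    "map (resampled r) ts \<in> Words (set (clist H)) H v" "consistent r (map (resampled r) ts)"
    using obtain_history[OF mH] by blast
  have "?S \<subseteq> set ts"
  proof
    fix s assume s: "s \<in> ?S"
    then have "s \<le> m" using S(1) by (simp add: m_def)
    show "s \<in> set ts"
    proof (cases "s = m")
      case False
      then have "dep (resampled r) s m" using s mH \<open>s \<le> m\<close> by (auto simp: dep_def)
      then show ?thesis using ts(1,2) \<open>s \<le> m\<close> by (auto simp: history_def)
    qed (use ts in simp)
  qed
  then have "card ?S \<le> length ts" using card_mono[of "set ts" ?S] card_length[of ts] by simp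
  moreover have "length (map (resampled r) ts) \<le> weight (map (resampled r) ts)"
    using Words_subset[OF ts(4)] clist_member by (intro length_word_le_weight) blast
  ultimately show ?thesis unfolding bad_def using ts assms(2) by (intro bexI[of _ "map (resampled r) ts"]) auto
qed

text \<open>While some clause of \<open>clist s\<close> is violated, priority makes every step
  resample a clause of that list and so charge a variable below \<open>bound s\<close>. Each of
  these variables can be charged fewer than \<open>R\<close> times.\<close>

lemma quiet_moment:
  assumes "R > 0" "s + bound s * R < t" "t \<le> H" "\<And>v. v < bound s \<Longrightarrow> \<not> bad H R v r"
  shows "\<exists>t'. s \<le> t' \<and> t' < t \<and> (\<forall>c\<in>set (clist s). \<not> viol r (log r t') c)"
proof (rule ccontr)
  assume "\<not> ?thesis"
  then have "resampled r t' \<in> set (clist s)" if "s \<le> t'" "t' < t" for t'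
    using that resampled_priority by blast
  then have ex: "\<exists>v<bound s. v \<in> vars (resampled r t')" if "s \<le> t'" "t' < t" for t'
    using that clist_member less_bound by (metis image_eqI list.set_intros(1) neq_Nil_conv)
  let ?S = "\<lambda>v. {u. u < t \<and> v \<in> vars (resampled r u)}"
  have "t - s = card {s..<t}" by simp
  also have "\<dots> \<le> card (\<Union>v\<in>{..<bound s}. ?S v)"
    using ex by (intro card_mono) fastforce+
  also have "\<dots> \<le> (\<Sum>v<bound s. card (?S v))" by (rule card_UN_le) simp
  also have "\<dots> \<le> (\<Sum>v<bound s. R)"
    using frequent_bad[OF assms(1) _ assms(3)] assms(4) by (intro sum_mono) (metis lessThan_iff linear)
  finally show False using assms(2) by simp
qed

text \<open>An upper bound on the variables within \<open>h\<close> steps of those below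
  \<open>m\<close>, where a step passes through a clause of size less than \<open>K\<close>. Adding
  \<open>u\<close> keeps the bounds increasing.\<close>

definition reach :: "nat \<Rightarrow> nat \<Rightarrow> nat \<Rightarrow> nat" where
  "reach K m h = rec_nat m (\<lambda>_ u. u + bound (prod_encode (u, K))) h"

lemma reach_simps[simp]: "reach K m 0 = m"
  "reach K m (Suc h) = reach K m h + bound (prod_encode (reach K m h, K))"
  by (simp_all add: reach_def)

lemma reach_mono: "h \<le> h' \<Longrightarrow> reach K m h \<le> reach K m h'"
  by (induction rule: dec_induct) auto

text \<open>By \<open>B_closed\<close> the clause can be looked up at its variable \<open>u\<close>,
  and the index of that lookup is small because \<open>u\<close> and the size are.\<close>

lemma clist_reach:
  assumes "c \<in> set (clist t)" "u \<in> vars c" "u < x" "length c < K"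
  shows "c \<in> set (clist (prod_encode (x, K)))"
proof -
  obtain i n where c: "c \<in> set (B i n)" using assms(1) by (auto simp: clist_member_iff)
  then have "length c = n" using B_member by blast
  with B_closed[OF c assms(2)] have "c \<in> set (B u (length c))" by simp
  moreover have "prod_encode (u, length c) < prod_encode (x, K)"
    using assms by (intro prod_encode_strict_mono) auto
  ultimately show ?thesis by (auto simp: clist_member_iff)
qed

text \<open>Lightness forces all clauses below size \<open>K\<close>. Descending into a subword
  moves one level further in \<open>reach\<close>, but the subword has lost at least the root
  clause, so \<open>j + length w\<close> levels suffice.\<close>

lemma Words_reach:
  assumes "w \<in> Words (set (clist t)) h v" "weight w < K" "v < reach K m j" "e \<in> set w"
  shows "\<exists>u<reach K m (j + length w). u \<in> vars e"
  using assms
proof (induction h arbitrary: w v j)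
  case (Suc h)
  then obtain c w' where c: "c \<in> set (clist t)" "v \<in> vars c" "w = w' @ [c]"
    "w' \<in> cats (map (\<lambda>l. insert [] (Words (set (clist t)) h (fst l))) c)" by auto
  show ?case
  proof (cases "e = c")
    case True
    then show ?thesis using c Suc.prems(3) reach_mono[of j "j + length w" K m] by (meson le_add1 less_le_trans)
  next
    case False
    then have "e \<in> set w'" using Suc.prems c by simp
    from cats_member[OF c(4) this] obtain l p where
      p: "l \<in> set c" "p \<in> Words (set (clist t)) h (fst l)" "e \<in> set p" "length p \<le> length w'" "weight p \<le> weight w'"
      by auto
    have "c \<in> set (clist (prod_encode (reach K m j, K)))"
      using clist_reach[OF c(1,2) Suc.prems(3)] Suc.prems(2) c(3) by simp
    then have "fst l < reach K m (Suc j)" using less_bound p(1) by (fastforce simp: trans_less_add2)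
    moreover have "weight p < K" using p(5) Suc.prems(2) c(3) by simp
    ultimately have "\<exists>u<reach K m (Suc j + length p). u \<in> vars e"
      using Suc.IH[OF p(2) _ _ p(3)] by blast
    moreover have "reach K m (Suc j + length p) \<le> reach K m (j + length w)"
      using p(4) c(3) by (intro reach_mono) simp
    ultimately show ?thesis by (meson less_le_trans)
  qed
qed simp

text \<open>A resampling of \<open>v\<close> after the quiet moment \<open>t'\<close> would have a
  light history, hence one made of clauses satisfied at \<open>t'\<close>. The first clause of it
  resampled from \<open>t'\<close> on became violated through an even earlier resampling after
  \<open>t'\<close>, which by closure also belongs to the history.\<close>

lemma stable:
  assumes quiet: "\<forall>c\<in>set (clist (prod_encode (reach K m K, K))). \<not> viol r (log r t') c"
    and good: "\<And>v. v < m \<Longrightarrow> \<not> bad H K v r"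
    and "t' \<le> t" "t < H" "v < m"
  shows "v \<notin> vars (resampled r t)"
proof
  assume v: "v \<in> vars (resampled r t)"
  obtain ts where ts: "history (resampled r) {..t} ts" "t \<in> set ts" "length ts \<le> H"
    "map (resampled r) ts \<in> Words (set (clist H)) H v" "consistent r (map (resampled r) ts)"
    using obtain_history[OF assms(4) v] by blast
  let ?w = "map (resampled r) ts"
  have K: "weight ?w < K" using good[OF assms(5)] ts unfolding bad_def by (metis length_map not_le)
  have wF: "set ?w \<subseteq> set (clist H)" by (rule Words_subset[OF ts(4)])
  then have "length ?w \<le> weight ?w" using clist_member by (intro length_word_le_weight) blast
  \<comment> \<open>The bound \<open>K\<close> on the weight limits the size of the clauses and also
    their number, whence both occurrences of \<open>K\<close> in \<open>reach K m K\<close>.\<close>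
  then have "length ?w \<le> K" using K by simp
  have local: "resampled r s \<in> set (clist (prod_encode (reach K m K, K)))" if "s \<in> set ts" for s
  proof -
    have e: "resampled r s \<in> set ?w" using that by simp
    obtain u where u: "u < reach K m (length ?w)" "u \<in> vars (resampled r s)"
      using Words_reach[OF ts(4) K _ e, of m 0] assms(5) by auto
    have "reach K m (length ?w) \<le> reach K m K" by (rule reach_mono) fact
    then have "u < reach K m K" using u(1) by simp
    moreover have "length (resampled r s) < K" using length_le_weight[OF e] K by simp
    moreover have "resampled r s \<in> set (clist H)" using wF e by blast
    ultimately show ?thesis using clist_reach u(2) by blast
  qed
  \<comment> \<open>The minimal counterexample: the first time from \<open>t'\<close> on in the
    history.\<close>
  define s where "s = Min (set ts \<inter> {t'..})"
  have ne: "finite (set ts \<inter> {t'..})" "set ts \<inter> {t'..} \<noteq> {}" using ts(2) assms(3) by auto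
  then have s: "s \<in> set ts" "t' \<le> s" using Min_in[OF ne] by (auto simp: s_def)
  have "s \<le> t" using s(1) ts(1) by (auto simp: history_def)
  have "\<not> viol r (log r t') (resampled r s)" using quiet local[OF s(1)] by blast
  moreover have "viol r (log r s) (resampled r s)"
    using local[OF s(1)] clist_member resampled_cases by blast
  ultimately obtain l where l: "l \<in> set (resampled r s)" "val r (log r s) (fst l) \<noteq> val r (log r t') (fst l)"
    by (auto simp: viol_def list_all_iff)
  then have "cnt (fst l) (log r s) \<noteq> cnt (fst l) (log r t')" by (auto simp: val_def)
  then obtain u where u: "t' \<le> u" "u < s" "fst l \<in> vars (resampled r u)"
    using cnt_log_eq[OF s(2)] by blast
  then have "dep (resampled r) u s" using l(1) by (auto simp: dep_def)
  then have "u \<in> set ts" using ts(1) s(1) u(2) \<open>s \<le> t\<close> by (auto simp: history_def)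
  then have "s \<le> u" using ne(1) u(1) by (simp add: s_def)
  then show False using u(2) by simp
qed

end

subsection \<open>Extracting a computable assignment\<close>

lemma cmp_cnt[cmp_intros]: "cmp f \<Longrightarrow> cmp g \<Longrightarrow> cmp (\<lambda>x. cnt (f x) (g x))"
  by (rule cmp2, unfold cnt_def) (intro cmp_intros, assumption+)

lemma cmp_val[cmp_intros]: "cmp f \<Longrightarrow> cmp g \<Longrightarrow> cmp h \<Longrightarrow> cmp (\<lambda>x. val (f x) (g x) (h x))"
  by (rule cmp3, unfold val_def) (intro cmp_intros, assumption+)

lemma cmp_viol[cmp_intros]: "cmp f \<Longrightarrow> cmp g \<Longrightarrow> cmp h \<Longrightarrow> cmp (\<lambda>x. viol (f x) (g x) (h x))"
  by (rule cmp3, unfold viol_def) (intro cmp_intros, assumption+)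

text \<open>Membership depends only on the remainder modulo \<open>2 ^ L\<close>, and the quotient
  ranges freely over \<open>2 ^ (L' - L)\<close> values; the density of tables is unchanged.\<close>

lemma card_mod_power:
  fixes P :: "nat \<Rightarrow> bool"
  assumes "\<And>r. P (r mod 2 ^ L) \<longleftrightarrow> P r" "L \<le> L'"
  shows "card {r. r < 2 ^ L' \<and> P r} = 2 ^ (L' - L) * card {r. r < 2 ^ L \<and> P r}"
proof -
  have pow: "(2::nat) ^ L' = 2 ^ (L' - L) * 2 ^ L" using assms(2) by (simp flip: power_add)
  have P: "P (a * 2 ^ L + b) \<longleftrightarrow> P b" if "b < 2 ^ L" for a b
    using assms(1)[of "a * 2 ^ L + b"] assms(1)[of b] that by simp
  let ?A = "{..<2 ^ (L' - L)} :: nat set" and ?S = "{r. r < 2 ^ L \<and> P r}"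
  have "bij_betw (\<lambda>(a, b). a * 2 ^ L + b) (?A \<times> ?S) {r. r < 2 ^ L' \<and> P r}"
  proof (rule bij_betwI[where g = "\<lambda>r. (r div 2 ^ L, r mod 2 ^ L)"])
    show "(\<lambda>(a, b). a * 2 ^ L + b) \<in> ?A \<times> ?S \<rightarrow> {r. r < 2 ^ L' \<and> P r}"
    proof
      fix p assume "p \<in> ?A \<times> ?S"
      then obtain a b where p: "p = (a, b)" "a < 2 ^ (L' - L)" "b < 2 ^ L" "P b" by auto
      then have "(a + 1) * 2 ^ L \<le> 2 ^ (L' - L) * 2 ^ L" by (intro mult_right_mono) auto
      then show "(case p of (a, b) \<Rightarrow> a * 2 ^ L + b) \<in> {r. r < 2 ^ L' \<and> P r}"
        using p by (simp add: pow P)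
    qed
    show "(\<lambda>r. (r div 2 ^ L, r mod 2 ^ L)) \<in> {r. r < 2 ^ L' \<and> P r} \<rightarrow> ?A \<times> ?S"
      by (auto simp: pow assms(1) less_mult_imp_div_less)
  qed (auto simp: div_mult_mod_eq)
  from bij_betw_same_card[OF this] show ?thesis by (simp add: card_cartesian_product)
qed

context clause_system
begin

section \<open>Dependence of a run on finitely many table bits\<close>

lemma length_log[simp]: "length (log r t) = t"
  by (induction t) auto

lemma val_cong:
  assumes "\<And>z. z < L \<Longrightarrow> bit r z = bit r' z" "prod_encode (V, t) \<le> L" "v < V" "length w \<le> t"
  shows "val r w v = val r' w v"
proof -
  have "prod_encode (v, cnt v w) < L"
    using prod_encode_strict_mono[OF assms(3), of "cnt v w" t] cnt_le_length[of v w] assms(2,4) by simp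
  then show ?thesis using assms(1) by (simp add: val_def)
qed

text \<open>Up to time \<open>t\<close> only variables below \<open>bound t\<close> are inspected,
  with counters at most \<open>t\<close>, so all bits read lie below \<open>L\<close>.\<close>

lemma log_cong:
  assumes "\<And>z. z < L \<Longrightarrow> bit r z = bit r' z" "prod_encode (bound t, t) \<le> L" "s \<le> t"
  shows "log r s = log r' s"
  using assms(3)
proof (induction s)
  case (Suc s)
  have "val r (log r s) v = val r' (log r s) v" if "v < bound s" for v
    using val_cong[OF assms(1,2), of v "log r s"] bound_mono[of s t] Suc.prems that by simp
  then have "viol r (log r s) c = viol r' (log r s) c" if "c \<in> set (clist s)" for c
    using less_bound[OF that] by (auto simp: viol_def list_all_iff)
  then have "filter (viol r (log r s)) (clist s) = filter (viol r' (log r s)) (clist s)"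
    by (intro filter_cong) auto
  then have "pick r s (log r s) = pick r' s (log r s)" by (simp add: pick_def)
  moreover have "log r s = log r' s" using Suc by simp
  ultimately show ?case by (simp add: resampled_def)
qed simp

end

text \<open>The factor \<open>\<sigma>\<close> is slack in the branching estimate: even with letters
  weighted by \<open>1 / (2 * \<sigma>)\<close> rather than \<open>1 / 2\<close>, the words at a
  variable sum to at most one. Each \<open>q\<close> units of weight convert this slack into a
  factor \<open>1 / 2\<close>, which gives an explicit rate of decay.\<close>

locale weighted_clause_system = clause_system +
  fixes \<sigma> :: real and q :: nat
  assumes q_pos: "q > 0" and \<sigma>: "0 < \<sigma>" "\<sigma> \<le> 1" "\<sigma> ^ q = 1 / 2"
    and Words_weight: "finite F \<Longrightarrow> F \<subseteq> (\<Union>i n. set (B i n)) \<Longrightarrow>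
      (\<Sum>w\<in>Words F h v. (1 / (2 * \<sigma>)) ^ weight w) \<le> 1"
begin

text \<open>A union bound over the heavy words, each counted by
  \<open>card_consistent_le\<close>.\<close>

lemma card_bad:
  assumes "prod_encode (bound H, H) \<le> L"
  shows "real (card {r. r < 2 ^ L \<and> bad H (q * k) v r}) \<le> 2 ^ L / 2 ^ k"
proof -
  let ?W = "{w \<in> Words (set (clist H)) H v. length w \<le> H \<and> q * k \<le> weight w}"
  have fin: "finite (Words (set (clist H)) H v)" by (simp add: finite_Words)
  have "card {r. r < 2 ^ L \<and> bad H (q * k) v r} \<le> card (\<Union>w\<in>?W. {r. r < 2 ^ L \<and> consistent r w})"
    by (intro card_mono) (auto simp: bad_def fin)
  also have "\<dots> \<le> (\<Sum>w\<in>?W. card {r. r < 2 ^ L \<and> consistent r w})"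
    by (rule card_UN_le) (simp add: fin)
  finally have "real (card {r. r < 2 ^ L \<and> bad H (q * k) v r})
      \<le> (\<Sum>w\<in>?W. real (card {r. r < 2 ^ L \<and> consistent r w}))"
    by (simp flip: of_nat_sum)
  also have "\<dots> \<le> (\<Sum>w\<in>?W. 2 ^ L / 2 ^ k * (1 / (2 * \<sigma>)) ^ weight w)"
  proof (rule sum_mono)
    fix w assume w: "w \<in> ?W"
    have sub: "set w \<subseteq> set (clist H)" using Words_subset[of w] w by blast
    have "card {r. r < 2 ^ L \<and> consistent r w} * 2 ^ weight w \<le> 2 ^ L"
    proof (rule card_consistent_le)
      show "prod_encode (bound H, length w) \<le> L"
        using w prod_encode_mono[of "bound H" "bound H" "length w" H] assms by simp
    qed (use sub clist_member less_bound in blast)+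
    then have "real (card {r. r < 2 ^ L \<and> consistent r w} * 2 ^ weight w) \<le> real (2 ^ L)"
      by (simp only: of_nat_le_iff)
    then have "real (card {r. r < 2 ^ L \<and> consistent r w}) * 2 ^ weight w \<le> 2 ^ L"
      by (simp only: of_nat_mult of_nat_power of_nat_numeral)
    then have "real (card {r. r < 2 ^ L \<and> consistent r w}) \<le> 2 ^ L * (1 / 2) ^ weight w"
      by (simp add: field_simps)
    \<comment> \<open>The first factor yields \<open>2\<close> to the minus \<open>k\<close> from
      heaviness; the second is left for the summation over all words.\<close>
    also have "\<dots> = 2 ^ L * (\<sigma> ^ weight w * (1 / (2 * \<sigma>)) ^ weight w)"
      using \<sigma> by (simp flip: power_mult_distrib)
    also have "\<dots> \<le> 2 ^ L * ((1 / 2) ^ k * (1 / (2 * \<sigma>)) ^ weight w)"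
    proof (intro mult_left_mono mult_right_mono)
      have "\<sigma> ^ weight w \<le> \<sigma> ^ (q * k)" using w \<sigma> by (intro power_decreasing) auto
      also have "\<dots> = (1 / 2) ^ k" by (simp add: power_mult \<sigma>)
      finally show "\<sigma> ^ weight w \<le> (1 / 2) ^ k" .
    qed (use \<sigma> in auto)
    finally show "real (card {r. r < 2 ^ L \<and> consistent r w}) \<le> 2 ^ L / 2 ^ k * (1 / (2 * \<sigma>)) ^ weight w"
      by (simp add: power_divide)
  qed
  also have "\<dots> \<le> (\<Sum>w\<in>Words (set (clist H)) H v. 2 ^ L / 2 ^ k * (1 / (2 * \<sigma>)) ^ weight w)"
    using \<sigma> by (intro sum_mono2 fin) auto
  also have "\<dots> \<le> 2 ^ L / 2 ^ k * 1"
    unfolding sum_distrib_left[symmetric]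
  proof (intro mult_left_mono Words_weight)
    show "set (clist H) \<subseteq> (\<Union>i n. set (B i n))"
    proof
      fix c assume "c \<in> set (clist H)"
      then obtain i n where "c \<in> set (B i n)" unfolding clist_member_iff by blast
      then show "c \<in> (\<Union>i n. set (B i n))" by blast
    qed
  qed auto
  finally show ?thesis by simp
qed

text \<open>
  At stage \<open>m\<close> words of weight at least \<open>reso m\<close> at the variables below \<open>m\<close> are neglected, so that only the
  clauses of \<open>clist (scope m)\<close> matter to these variables. If no variable of that list is resampled
  \<open>quota m\<close> times, then all its clauses are satisfied at some moment before \<open>time m\<close>, and from
  then on the first \<open>m\<close> values are stable.
\<close>

definition reso :: "nat \<Rightarrow> nat" where
  "reso m = q * (3 * m + 4)"

definition scope :: "nat \<Rightarrow> nat" where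
  "scope m = prod_encode (reach (reso m) m (reso m), reso m)"

definition quota :: "nat \<Rightarrow> nat" where
  "quota m = q * (2 * m + 4 + bound (scope m))"

text \<open>Summation over all stages up to \<open>m\<close> makes the times monotone, and
  \<open>Suc\<close> provides the strict inequality for \<open>quiet_moment\<close>.\<close>

definition time :: "nat \<Rightarrow> nat" where
  "time m = sum_list (map (\<lambda>i. Suc (scope i + bound (scope i) * quota i)) [0..<Suc m])"

text \<open>The summand \<open>m\<close> covers the reading of the first \<open>m\<close> values,
  the summand \<open>bound (time m)\<close> the run up to \<open>time m\<close>.\<close>

definition bits :: "nat \<Rightarrow> nat" where
  "bits m = prod_encode (m + bound (time m), time m)"

definition agrees :: "nat \<Rightarrow> bool list \<Rightarrow> nat \<Rightarrow> bool" where
  "agrees m w r \<longleftrightarrow> map (val r (log r (time m))) [0..<length w] = w"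

definition count :: "nat \<Rightarrow> bool list \<Rightarrow> nat" where
  "count m w = length (filter (agrees m w) [0..<2 ^ bits m])"

text \<open>The prefix is extended by the bit that more tables support at the next stage, as in the
  method of conditional probabilities.\<close>

definition initial :: "nat \<Rightarrow> bool list" where
  "initial m = rec_nat [] (\<lambda>m w. w @ [count (Suc m) (w @ [False]) \<le> count (Suc m) (w @ [True])]) m"

text \<open>The last entry of the prefix, written with operations already shown computable.\<close>

definition assignment :: "nat \<Rightarrow> bool" where
  "assignment m = hd (rev (initial (Suc m)))"

lemma cmp_assignment:
  assumes "cmp (\<lambda>p. B (fst p) (snd p))"
  shows "cmp assignment"
proof -
  have clist: "cmp (\<lambda>x. clist (f x))" if "cmp f" for f :: "'a::enc \<Rightarrow> nat"
    unfolding clist_def by (intro cmp_intros cmp2[OF assms] that)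
  have bound: "cmp (\<lambda>x. bound (f x))" if "cmp f" for f :: "'a::enc \<Rightarrow> nat"
    unfolding bound_def by (intro cmp_intros clist that)
  have "cmp (\<lambda>p. pick (fst p) (fst (snd p)) (snd (snd p)))"
    unfolding pick_def by (intro cmp_intros clist)
  note pick = cmp3[OF this]
  have "cmp (\<lambda>p. log (fst p) (snd p))"
    unfolding log_def by (intro cmp_intros pick)
  note log = cmp2[OF this]
  have "cmp (\<lambda>p. reach (fst p) (fst (snd p)) (snd (snd p)))"
    unfolding reach_def by (intro cmp_intros bound)
  note reach = cmp3[OF this]
  have reso: "cmp (\<lambda>x. reso (f x))" if "cmp f" for f :: "'a::enc \<Rightarrow> nat"
    unfolding reso_def by (intro cmp_intros that)
  have scope: "cmp (\<lambda>x. scope (f x))" if "cmp f" for f :: "'a::enc \<Rightarrow> nat"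
    unfolding scope_def by (intro cmp_intros reach reso that)
  have quota: "cmp (\<lambda>x. quota (f x))" if "cmp f" for f :: "'a::enc \<Rightarrow> nat"
    unfolding quota_def by (intro cmp_intros bound scope that)
  have time: "cmp (\<lambda>x. time (f x))" if "cmp f" for f :: "'a::enc \<Rightarrow> nat"
    unfolding time_def by (intro cmp_intros bound scope quota that)
  have bits: "cmp (\<lambda>x. bits (f x))" if "cmp f" for f :: "'a::enc \<Rightarrow> nat"
    unfolding bits_def by (intro cmp_intros bound time that)
  have "cmp (\<lambda>p. agrees (fst p) (fst (snd p)) (snd (snd p)))"
    unfolding agrees_def by (intro cmp_intros log time)
  note agrees = cmp3[OF this]
  have "cmp (\<lambda>p. count (fst p) (snd p))"
    unfolding count_def by (intro cmp_intros agrees bits)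
  note count = cmp2[OF this]
  have initial: "cmp (\<lambda>x. initial (f x))" if "cmp f" for f :: "'a::enc \<Rightarrow> nat"
    unfolding initial_def by (intro cmp_intros count that)
  show ?thesis
    unfolding assignment_def by (intro cmp_intros initial)
qed

section \<open>Correctness of the extracted assignment\<close>

lemma initial_simps[simp]: "initial 0 = []"
  "initial (Suc m) = initial m @ [count (Suc m) (initial m @ [False]) \<le> count (Suc m) (initial m @ [True])]"
  by (simp_all add: initial_def)

lemma initial_eq: "initial m = map assignment [0..<m]"
proof (induction m)
  case (Suc m)
  have "initial (Suc m) = initial m @ [assignment m]" by (simp add: assignment_def)
  then show ?case using Suc by simp
qed simp

lemma length_initial[simp]: "length (initial m) = m"
  by (simp add: initial_eq)

lemma time_Suc: "time m \<le> time (Suc m)"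
  by (simp add: time_def)

lemma scope_less_time: "scope m + bound (scope m) * quota m < time m"
  by (simp add: time_def)

lemma bits_Suc: "bits m \<le> bits (Suc m)"
  unfolding bits_def using time_Suc[of m] bound_mono[OF time_Suc[of m]] by (intro prod_encode_mono) auto

lemma count_eq: "count m w = card {r. r < 2 ^ bits m \<and> agrees m w r}"
  unfolding count_def length_filter_conv_card by (rule arg_cong[where f = card]) auto

lemma agrees_mod:
  assumes "length w \<le> m"
  shows "agrees m w (r mod 2 ^ bits m) \<longleftrightarrow> agrees m w r"
proof -
  have eq: "bit (r mod 2 ^ bits m) z = bit r z" if "z < bits m" for z
    using that by (simp flip: take_bit_eq_mod add: bit_take_bit_iff)
  have "log (r mod 2 ^ bits m) (time m) = log r (time m)"
    using eq by (rule log_cong) (auto simp: bits_def intro: prod_encode_mono)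
  moreover have "val (r mod 2 ^ bits m) (log r (time m)) v = val r (log r (time m)) v" if "v < length w" for v
    using eq by (rule val_cong[where V = "m + bound (time m)" and t = "time m"])
      (use that assms in \<open>auto simp: bits_def\<close>)
  ultimately have "map (val (r mod 2 ^ bits m) (log (r mod 2 ^ bits m) (time m))) [0..<length w]
      = map (val r (log r (time m))) [0..<length w]"
    by simp
  then show ?thesis by (simp only: agrees_def)
qed

text \<open>The first condition makes the first \<open>m\<close> values stable after a quiet moment,
  the second provides that moment. The horizon is the next stage, so that stages \<open>m\<close>
  and \<open>Suc m\<close> can be compared.\<close>

definition good :: "nat \<Rightarrow> nat \<Rightarrow> bool" where
  "good m r \<longleftrightarrow> (\<forall>v<m. \<not> bad (time (Suc m)) (reso m) v r) \<and>
     (\<forall>v<bound (scope m). \<not> bad (time (Suc m)) (quota m) v r)"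

text \<open>\<open>quiet_moment\<close> is applied to the list \<open>clist (scope m)\<close> with
  \<open>quota m\<close>, then \<open>stable\<close> from the moment found.\<close>

lemma good_quiet:
  assumes "good m r"
  obtains t' where "t' < time m" "\<And>c. c \<in> set (clist (scope m)) \<Longrightarrow> \<not> viol r (log r t') c"
    "\<And>v t. v < m \<Longrightarrow> t' \<le> t \<Longrightarrow> t \<le> time (Suc m) \<Longrightarrow> val r (log r t) v = val r (log r t') v"
proof -
  have "quota m > 0" using q_pos by (simp add: quota_def)
  then obtain t' where t': "t' < time m" "\<forall>c\<in>set (clist (scope m)). \<not> viol r (log r t') c"
    using quiet_moment[OF _ scope_less_time[of m] time_Suc[of m]] assms unfolding good_def by blast
  have "val r (log r t) v = val r (log r t') v" if "v < m" "t' \<le> t" "t \<le> time (Suc m)" for v t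
  proof -
    have "v \<notin> vars (resampled r u)" if "t' \<le> u" "u < t" for u
      using stable[OF t'(2)[unfolded scope_def], of "time (Suc m)" u v] assms that \<open>v < m\<close> \<open>t \<le> _\<close>
      unfolding good_def by auto
    then have "cnt v (log r t) = cnt v (log r t')" using cnt_log_eq that(2) by blast
    then show ?thesis by (simp add: val_def)
  qed
  then show ?thesis using that t' by blast
qed

lemma good_agrees:
  assumes "good m r" "v < m"
  shows "val r (log r (time (Suc m))) v = val r (log r (time m)) v"
proof -
  obtain t' where t': "t' < time m"
    "\<And>v t. v < m \<Longrightarrow> t' \<le> t \<Longrightarrow> t \<le> time (Suc m) \<Longrightarrow> val r (log r t) v = val r (log r t') v"
    using good_quiet[OF assms(1)] by metis
  show ?thesis using t'(2)[OF assms(2), of "time m"] t'(2)[OF assms(2), of "time (Suc m)"]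
    t'(1) time_Suc[of m] by simp
qed

lemma good_satisfies:
  assumes "good m r" "c \<in> set (clist (scope m))" "\<And>v. v \<in> vars c \<Longrightarrow> v < m"
  shows "\<exists>l\<in>set c. val r (log r (time m)) (fst l) = snd l"
proof -
  obtain t' where t': "t' < time m" "\<not> viol r (log r t') c"
    "\<And>v t. v < m \<Longrightarrow> t' \<le> t \<Longrightarrow> t \<le> time (Suc m) \<Longrightarrow> val r (log r t) v = val r (log r t') v"
    using good_quiet[OF assms(1)] assms(2) by metis
  from t'(2) obtain l where "l \<in> set c" "val r (log r t') (fst l) = snd l"
    by (auto simp: viol_def list_all_iff)
  then show ?thesis
    using t'(1) t'(3)[of "fst l" "time m"] assms(3) time_Suc[of m] by (intro bexI[of _ l]) auto
qed

text \<open>In both \<open>reso\<close> and \<open>quota\<close> the number \<open>n\<close> of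
  variables appears as a summand, and \<open>n \<le> 2 ^ n\<close> pays for the union bound. The
  remaining \<open>2 * m + 4\<close> makes each of the two families contribute half of the stated
  bound.\<close>

lemma card_not_good:
  "real (card {r. r < 2 ^ bits (Suc m) \<and> \<not> good m r}) \<le> 2 ^ bits (Suc m) / 2 ^ (2 * m + 3)"
proof -
  let ?L = "bits (Suc m)" and ?H = "time (Suc m)" and ?V = "bound (scope m)"
  have L: "prod_encode (bound ?H, ?H) \<le> ?L" unfolding bits_def by (rule prod_encode_mono) auto
  have few: "real (card {r. r < 2 ^ ?L \<and> (\<exists>v<n. bad ?H (q * (n + k)) v r)}) \<le> 2 ^ ?L / 2 ^ k" for n k
  proof -
    have "{r. r < 2 ^ ?L \<and> (\<exists>v<n. bad ?H (q * (n + k)) v r)}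
        = (\<Union>v\<in>{..<n}. {r. r < 2 ^ ?L \<and> bad ?H (q * (n + k)) v r})" by auto
    then have "card {r. r < 2 ^ ?L \<and> (\<exists>v<n. bad ?H (q * (n + k)) v r)}
        \<le> (\<Sum>v<n. card {r. r < 2 ^ ?L \<and> bad ?H (q * (n + k)) v r})"
      using card_UN_le[of "{..<n}"] by simp
    then have "real (card {r. r < 2 ^ ?L \<and> (\<exists>v<n. bad ?H (q * (n + k)) v r)})
        \<le> (\<Sum>v<n. real (card {r. r < 2 ^ ?L \<and> bad ?H (q * (n + k)) v r}))"
      by (simp flip: of_nat_sum)
    also have "\<dots> \<le> (\<Sum>v<n. 2 ^ ?L / 2 ^ (n + k))"
      by (intro sum_mono card_bad[OF L])
    also have "\<dots> = 2 ^ ?L / 2 ^ k * (real n / 2 ^ n)" by (simp add: power_add mult_ac)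
    also have "\<dots> \<le> 2 ^ ?L / 2 ^ k * 1"
      by (intro mult_left_mono) (auto simp: less_imp_le of_nat_less_two_power)
    finally show ?thesis by simp
  qed
  have "{r. r < 2 ^ ?L \<and> \<not> good m r} =
      {r. r < 2 ^ ?L \<and> (\<exists>v<m. bad ?H (q * (m + (2 * m + 4))) v r)} \<union>
      {r. r < 2 ^ ?L \<and> (\<exists>v<?V. bad ?H (q * (?V + (2 * m + 4))) v r)}"
    by (auto simp: good_def reso_def quota_def add.commute)
  then have "card {r. r < 2 ^ ?L \<and> \<not> good m r} \<le>
      card {r. r < 2 ^ ?L \<and> (\<exists>v<m. bad ?H (q * (m + (2 * m + 4))) v r)} +
      card {r. r < 2 ^ ?L \<and> (\<exists>v<?V. bad ?H (q * (?V + (2 * m + 4))) v r)}"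
    by (simp add: card_Un_le)
  then have "real (card {r. r < 2 ^ ?L \<and> \<not> good m r}) \<le> 2 ^ ?L / 2 ^ (2 * m + 4) + 2 ^ ?L / 2 ^ (2 * m + 4)"
    using few[of m "2 * m + 4"] few[of ?V "2 * m + 4"] by linarith
  also have "\<dots> = 2 ^ ?L / 2 ^ (2 * m + 3)" by (simp add: power_add)
  finally show ?thesis .
qed

lemma card_agrees_Suc:
  "card {r. r < 2 ^ bits (Suc m) \<and> agrees m (initial m) r} = 2 ^ (bits (Suc m) - bits m) * count m (initial m)"
  using card_mod_power[of "agrees m (initial m)" "bits m" "bits (Suc m)"] agrees_mod bits_Suc
  by (simp add: count_eq)

text \<open>The better extension keeps at least half of the agreeing tables, up to the tables that
  are not good. The surplus term \<open>1 / 2 ^ Suc m\<close> is halved in passing to the next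
  stage, and this drop pays for that loss, so the density never reaches zero.\<close>

lemma count_initial: "2 ^ bits m / 2 ^ m * (1 / 2 + 1 / 2 ^ Suc m) \<le> real (count m (initial m))"
proof (induction m)
  case 0
  show ?case by (simp add: count_eq agrees_def)
next
  case (Suc m)
  let ?L = "bits (Suc m)"
  define E where "E b = {r. r < 2 ^ ?L \<and> agrees (Suc m) (initial m @ [b]) r}" for b
  have count_E: "count (Suc m) (initial m @ [b]) = card (E b)" for b
    by (simp add: count_eq E_def)
  \<comment> \<open>On a good table the first \<open>m\<close> values do not change between the two
    stages, so the new prefix extends \<open>initial m\<close> by one of two bits.\<close>
  have "{r. r < 2 ^ ?L \<and> agrees m (initial m) r} \<subseteq> E False \<union> E True \<union> {r. r < 2 ^ ?L \<and> \<not> good m r}"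
  proof (rule subsetI, rule UnCI)
    fix r assume r: "r \<in> {r. r < 2 ^ ?L \<and> agrees m (initial m) r}" "r \<notin> {r. r < 2 ^ ?L \<and> \<not> good m r}"
    then have "map (val r (log r (time (Suc m)))) [0..<m] = map (val r (log r (time m))) [0..<m]"
      by (simp add: good_agrees)
    also have "\<dots> = initial m" using r by (simp add: agrees_def)
    finally have "r \<in> E (val r (log r (time (Suc m))) m)"
      using r by (simp add: E_def agrees_def)
    then show "r \<in> E False \<union> E True" by (cases "val r (log r (time (Suc m))) m") auto
  qed
  then have "card {r. r < 2 ^ ?L \<and> agrees m (initial m) r} \<le> card (E False \<union> E True \<union> {r. r < 2 ^ ?L \<and> \<not> good m r})"
    by (intro card_mono) (auto simp: E_def)
  also have "\<dots> \<le> card (E False) + card (E True) + card {r. r < 2 ^ ?L \<and> \<not> good m r}"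
    by (meson add_le_mono1 card_Un_le le_trans)
  also have "card (E False) + card (E True) \<le> 2 * count (Suc m) (initial (Suc m))"
    using count_E[of True] count_E[of False]
    by (cases "count (Suc m) (initial m @ [False]) \<le> count (Suc m) (initial m @ [True])") simp_all
  finally have "real (card {r. r < 2 ^ ?L \<and> agrees m (initial m) r})
      \<le> 2 * real (count (Suc m) (initial (Suc m))) + real (card {r. r < 2 ^ ?L \<and> \<not> good m r})"
    by linarith
  moreover have "real (card {r. r < 2 ^ ?L \<and> agrees m (initial m) r})
      \<ge> 2 ^ (?L - bits m) * (2 ^ bits m / 2 ^ m * (1 / 2 + 1 / 2 ^ Suc m))"
    unfolding card_agrees_Suc of_nat_mult of_nat_power of_nat_numeral by (intro mult_left_mono Suc.IH) simp
  moreover have "(2::real) ^ (?L - bits m) * 2 ^ bits m = 2 ^ ?L"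
    using bits_Suc[of m] by (simp flip: power_add)
  moreover note card_not_good[of m]
  ultimately have "2 ^ ?L / 2 ^ m * (1 / 2 + 1 / 2 ^ Suc m) - 2 ^ ?L / 2 ^ (2 * m + 3)
      \<le> 2 * real (count (Suc m) (initial (Suc m)))"
    by (simp add: mult.assoc[symmetric])
  moreover have "2 * (2 ^ ?L / 2 ^ Suc m * (1 / 2 + 1 / 2 ^ Suc (Suc m)))
      \<le> 2 ^ ?L / 2 ^ m * (1 / 2 + 1 / 2 ^ Suc m) - (2::real) ^ ?L / 2 ^ (2 * m + 3)"
    by (simp add: field_simps power_add power_mult power2_eq_square)
  ultimately show ?case by linarith
qed

text \<open>At a late stage the tables agreeing with the chosen prefix outnumber those that are not
  good. A good table among them satisfies the clause with values that are those of
  \<open>assignment\<close>.\<close>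

lemma assignment_satisfies:
  assumes "c \<in> set (B i n)"
  shows "\<exists>l\<in>set c. assignment (fst l) = snd l"
proof -
  define x where "x = Suc (prod_encode (i, n))"
  have c: "c \<in> set (clist x)" using assms by (auto simp: clist_member_iff x_def)
  \<comment> \<open>Late enough for the clause to lie within \<open>scope m\<close> and for its
    variables to lie below \<open>m\<close>.\<close>
  define m where "m = max x (bound x)"
  have "m \<le> reach (reso m) m (reso m)" using reach_mono[of 0 "reso m" "reso m" m] by simp
  then have "x \<le> scope m"
    using le_prod_encode_1[of "reach (reso m) m (reso m)" "reso m"] by (simp add: scope_def m_def)
  then have scope: "c \<in> set (clist (scope m))" using c clist_mono by blast
  have vars: "v < m" if "v \<in> vars c" for v using less_bound[OF c that] by (simp add: m_def)
  let ?L = "bits (Suc m)"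
  have "2 ^ (?L - bits m) * (2 ^ bits m / 2 ^ m * (1 / 2 + 1 / 2 ^ Suc m))
      \<le> real (card {r. r < 2 ^ ?L \<and> agrees m (initial m) r})"
    unfolding card_agrees_Suc of_nat_mult of_nat_power of_nat_numeral
    by (intro mult_left_mono count_initial) simp
  moreover have "(2::real) ^ (?L - bits m) * 2 ^ bits m = 2 ^ ?L"
    using bits_Suc[of m] by (simp flip: power_add)
  moreover have "(2::real) ^ ?L / 2 ^ (2 * m + 3) < 2 ^ ?L / 2 ^ m * (1 / 2 + 1 / 2 ^ Suc m)"
    by (simp add: field_simps power_add power_mult power2_eq_square add_pos_pos)
  ultimately have "card {r. r < 2 ^ ?L \<and> \<not> good m r} < card {r. r < 2 ^ ?L \<and> agrees m (initial m) r}"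
    using card_not_good[of m] by (simp add: mult.assoc[symmetric])
  then have "\<not> {r. r < 2 ^ ?L \<and> agrees m (initial m) r} \<subseteq> {r. r < 2 ^ ?L \<and> \<not> good m r}"
    using card_mono[of "{r. r < 2 ^ ?L \<and> \<not> good m r}" "{r. r < 2 ^ ?L \<and> agrees m (initial m) r}"]
    by auto
  then obtain r where r: "agrees m (initial m) r" "good m r" by blast
  obtain l where l: "l \<in> set c" "val r (log r (time m)) (fst l) = snd l"
    using good_satisfies[OF r(2) scope vars] by blast
  have "fst l < m" using vars l(1) by simp
  moreover have "map (val r (log r (time m))) [0..<m] = map assignment [0..<m]"
    using r(1) by (simp add: agrees_def initial_eq)
  ultimately have "val r (log r (time m)) (fst l) = assignment (fst l)" by simp
  then show ?thesis using l by auto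
qed

end

subsection \<open>Effective formulas\<close>

text \<open>Decodes a clause code: the set bits are the literal codes. A set bit \<open>z\<close> of
  \<open>n\<close> satisfies \<open>z < 2 ^ z \<le> n\<close>, so the search below \<open>n\<close>
  finds them all.\<close>

definition lits :: "nat \<Rightarrow> lclause" where
  "lits n = map (\<lambda>z. (fst (prod_decode z), snd (prod_decode z) = 1)) (filter (bit n) [0..<n])"

lemma cmp_lits: "cmp lits"
  unfolding lits_def by (intro cmp_intros)

lemma lits_clause_code:
  assumes "is_clause c"
  shows "set (lits (clause_code c)) = c" "length (lits (clause_code c)) = clause_size c"
    "distinct (map fst (lits (clause_code c)))"
proof -
  have fin: "finite c" and inj: "inj_on fst c" using assms by (auto simp: is_clause_def)
  have bit: "bit (clause_code c) z \<longleftrightarrow> z \<in> lit_code ` c" for z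
  proof -
    have "bit (clause_code c) z \<longleftrightarrow> z \<in> set_decode (clause_code c)"
      by (simp add: set_decode_def bit_iff_odd)
    then show ?thesis using fin by (simp add: clause_code_def)
  qed
  have less: "z < n" if "bit n z" for n z :: nat
  proof -
    have "n div 2 ^ z \<noteq> 0" using that unfolding bit_iff_odd by (metis even_zero)
    then have "2 ^ z \<le> n" by (simp add: div_eq_0_iff)
    then show ?thesis using less_exp[of z] by linarith
  qed
  have positions: "set (filter (bit (clause_code c)) [0..<clause_code c]) = lit_code ` c"
    using less bit by auto
  have decode: "(fst (prod_decode (lit_code l)), snd (prod_decode (lit_code l)) = 1) = l" for l
    by (cases l) (auto simp: lit_code_def)
  show set: "set (lits (clause_code c)) = c"
    unfolding lits_def set_map positions image_image decode by simp
  have "length (lits (clause_code c)) = card (lit_code ` c)"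
    unfolding lits_def length_map positions[symmetric]
    by (rule distinct_card[symmetric]) simp
  also have "\<dots> = card c"
    by (rule card_image) (metis decode inj_onI)
  finally have len: "length (lits (clause_code c)) = card c" .
  then show "length (lits (clause_code c)) = clause_size c"
    using card_image[OF inj] by (simp add: clause_size_def clause_vars_def)
  have "distinct (lits (clause_code c))" using len set by (intro card_distinct) simp
  then show "distinct (map fst (lits (clause_code c)))" using inj set by (simp add: distinct_map)
qed

section \<open>The branching estimate and the choice of parameters\<close>

lemma sum_power_le:
  fixes \<theta> :: real
  assumes "0 \<le> \<theta>" "\<theta> < 1" "finite S" "\<And>n. n \<in> S \<Longrightarrow> N \<le> n"
  shows "(\<Sum>n\<in>S. \<theta> ^ n) \<le> \<theta> ^ N / (1 - \<theta>)"
proof -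
  obtain M where M: "\<And>n. n \<in> S \<Longrightarrow> n \<le> M" using assms(3) by (meson finite_nat_set_iff_bounded_le)
  have gp: "(1 - \<theta>) * (\<Sum>n\<in>{N..<N + k}. \<theta> ^ n) = \<theta> ^ N - \<theta> ^ (N + k)" for k
  proof (induction k)
    case (Suc k)
    have "(\<Sum>n\<in>{N..<N + Suc k}. \<theta> ^ n) = (\<Sum>n\<in>{N..<N + k}. \<theta> ^ n) + \<theta> ^ (N + k)" by simp
    then show ?case by (simp only: distrib_left Suc.IH) (simp add: algebra_simps)
  qed simp
  have "S \<subseteq> {N..<N + Suc M}" using assms(4) M by (force simp: less_Suc_eq_le intro: trans_le_add2)
  then have "(\<Sum>n\<in>S. \<theta> ^ n) \<le> (\<Sum>n\<in>{N..<N + Suc M}. \<theta> ^ n)"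
    using assms(1) by (intro sum_mono2) auto
  also have "\<dots> = (\<theta> ^ N - \<theta> ^ (N + Suc M)) / (1 - \<theta>)"
    unfolding gp[of "Suc M", symmetric] using assms(2) by simp
  also have "\<dots> \<le> \<theta> ^ N / (1 - \<theta>)"
    using assms(1,2) by (intro divide_right_mono) auto
  finally show ?thesis .
qed

text \<open>Grouped by size, the sum is dominated by a geometric tail with ratio
  \<open>2 powr \<alpha> / (2 * \<sigma>\<^sup>2)\<close>, and \<open>N\<close> is large enough to
  push that tail below \<open>y\<close>.\<close>

lemma branching_bound:
  fixes \<alpha> \<sigma> :: real
  assumes "0 < \<sigma>" "2 powr \<alpha> < 2 * \<sigma>\<^sup>2"
    and N: "(2 powr \<alpha> / (2 * \<sigma>\<^sup>2)) ^ N \<le> y * (1 - 2 powr \<alpha> / (2 * \<sigma>\<^sup>2))"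
    and F: "finite F" "\<And>c. c \<in> F \<Longrightarrow> N \<le> length c"
    and deg: "\<And>n. real (card {c \<in> F. length c = n}) \<le> 2 powr (\<alpha> * real n)"
  shows "(\<Sum>c\<in>F. (1 / (2 * \<sigma>\<^sup>2)) ^ length c) \<le> y"
proof -
  define \<theta> where "\<theta> = 2 powr \<alpha> / (2 * \<sigma>\<^sup>2)"
  have \<theta>: "0 \<le> \<theta>" "\<theta> < 1" using assms(1,2) by (auto simp: \<theta>_def)
  have "(\<Sum>c\<in>F. (1 / (2 * \<sigma>\<^sup>2)) ^ length c)
      = (\<Sum>n\<in>length ` F. \<Sum>c\<in>{c \<in> F. length c = n}. (1 / (2 * \<sigma>\<^sup>2)) ^ length c)"
    by (rule sum.image_gen[OF F(1)])
  also have "\<dots> = (\<Sum>n\<in>length ` F. real (card {c \<in> F. length c = n}) * (1 / (2 * \<sigma>\<^sup>2)) ^ n)"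
    by (intro sum.cong refl) simp
  also have "\<dots> \<le> (\<Sum>n\<in>length ` F. 2 powr (\<alpha> * real n) * (1 / (2 * \<sigma>\<^sup>2)) ^ n)"
    by (intro sum_mono mult_right_mono deg) simp
  also have "\<dots> = (\<Sum>n\<in>length ` F. \<theta> ^ n)"
    by (intro sum.cong refl) (simp add: \<theta>_def powr_powr[symmetric] powr_realpow power_divide)
  also have "\<dots> \<le> \<theta> ^ N / (1 - \<theta>)"
    using F by (intro sum_power_le \<theta>) auto
  also have "\<dots> \<le> y" using N \<theta>(2) by (simp add: \<theta>_def[symmetric] divide_le_eq)
  finally show ?thesis .
qed

theorem theorem4:
  fixes \<alpha> :: real
  assumes "0 < \<alpha>" and "\<alpha> < 1"
  shows "\<exists>N :: nat. \<forall>C :: nat \<Rightarrow> clause.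
           effective_cnf C \<longrightarrow>
           (\<forall>n i. real (card (clauses_with C i n)) \<le> 2 powr (\<alpha> * real n)) \<longrightarrow>
           (\<forall>j. N \<le> clause_size (C j)) \<longrightarrow>
           (\<exists>a :: nat \<Rightarrow> bool. computable_assignment a \<and> satisfies_cnf a C)"
proof -
  \<comment> \<open>The lower bound on \<open>q\<close> amounts to
    \<open>\<alpha> < 1 - 2 / q\<close>, that is,
    \<open>2 powr \<alpha> < 2 * \<sigma>\<^sup>2\<close> for the \<open>\<sigma>\<close>
    below.\<close>
  obtain q :: nat where q: "q > 0" "2 / (1 - \<alpha>) < real q"
    using reals_Archimedean2[of "2 / (1 - \<alpha>)"] assms
    by (metis divide_pos_pos diff_gt_0_iff_gt less_trans of_nat_0_less_iff zero_less_numeral)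
  define \<sigma> :: real where "\<sigma> = 2 powr (- (1 / q))"
  \<comment> \<open>Chosen so that \<open>1 + y = 1 / \<sigma>\<close>: one factor
    \<open>\<sigma>\<close> is spent on the decay of heavy words, a second on the branching.\<close>
  define y where "y = 1 / \<sigma> - 1"
  have "\<sigma> ^ q = 2 powr (- (1 / q) * q)"
    by (simp only: \<sigma>_def powr_powr[symmetric] powr_realpow powr_gt_zero)
  then have \<sigma>: "0 < \<sigma>" "\<sigma> < 1" "\<sigma> ^ q = 1 / 2"
    using q(1) by (auto simp: \<sigma>_def powr_minus_divide)
  have y: "0 < y" "y \<le> 1"
  proof -
    have "1 / 2 \<le> \<sigma>"
      \<comment> \<open>\<open>\<sigma> \<ge> \<sigma> ^ q = 1 / 2\<close>, which keeps
        \<open>y\<close>, and thus the total word weight, at most one.\<close>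
      using \<sigma> q(1) power_decreasing[of 1 q \<sigma>] by simp
    then show "0 < y" "y \<le> 1" using \<sigma> by (auto simp: y_def field_simps)
  qed
  have "2 * \<sigma>\<^sup>2 = 2 powr (1 - 2 / q)"
    by (simp add: \<sigma>_def powr_diff powr_minus_divide powr_power power_divide)
  moreover have "\<alpha> < 1 - 2 / q" using q assms by (simp add: field_simps)
  ultimately have \<alpha>: "2 powr \<alpha> < 2 * \<sigma>\<^sup>2" by simp
  define \<theta> where "\<theta> = 2 powr \<alpha> / (2 * \<sigma>\<^sup>2)"
  have \<theta>: "0 \<le> \<theta>" "\<theta> < 1" using \<alpha> \<sigma>(1) by (auto simp: \<theta>_def)
  obtain N where N: "\<theta> ^ N < y * (1 - \<theta>)"
    using real_arch_pow_inv[of "y * (1 - \<theta>)" \<theta>] y \<theta> by auto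
  show ?thesis
  \<comment> \<open>\<open>N\<close> takes care of the geometric tail; the successor also guarantees
    that every clause has a variable.\<close>
  proof (intro exI[of _ "Suc N"] allI impI)
    fix C
    assume eff: "effective_cnf C"
      and deg: "\<forall>n i. real (card (clauses_with C i n)) \<le> 2 powr (\<alpha> * real n)"
      and size: "\<forall>j. Suc N \<le> clause_size (C j)"
    obtain L where L: "\<And>i n. set (L i n) = clauses_with C i n"
      and comp: "computable2 (\<lambda>i n. list_encode (map clause_code (L i n)))"
      and clause: "\<And>j. is_clause (C j)"
      using eff unfolding effective_cnf_def by blast
    define B where "B i n = map lits (map clause_code (L i n))" for i n
    have mem: "\<exists>c. is_clause c \<and> Suc N \<le> clause_size c \<and> e = lits (clause_code c) \<and> c \<in> clauses_with C i n"
      if "e \<in> set (B i n)" for e i n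
      using that size clause by (auto simp: B_def L clauses_with_def)
    have setB: "set (B i n) = (\<lambda>c. lits (clause_code c)) ` clauses_with C i n" for i n
      by (auto simp: B_def L)
    interpret clause_system B
    proof
      fix e i n assume "e \<in> set (B i n)"
      then obtain c where c: "is_clause c" "e = lits (clause_code c)" "c \<in> clauses_with C i n"
        using mem by blast
      show "i \<in> vars e \<and> length e = n \<and> distinct (map fst e)"
        using lits_clause_code[OF c(1)] c(2,3) by (simp add: clauses_with_def clause_vars_def)
      fix u assume "u \<in> vars e"
      then have "c \<in> clauses_with C u n"
        using lits_clause_code[OF c(1)] c(2,3) by (simp add: clauses_with_def clause_vars_def)
      then show "e \<in> set (B u n)" using c(2) by (simp add: setB)
    qed
    interpret weighted_clause_system B \<sigma> q
    proof
      fix F h v assume F: "finite F" "F \<subseteq> (\<Union>i n. set (B i n))"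
      have "(\<Sum>w\<in>Words F h v. (1 / (2 * \<sigma>)) ^ weight w) \<le> y"
      proof (rule sum_Words_le[OF F(1)])
        fix v
        have deg': "real (card {c \<in> {c \<in> F. v \<in> vars c}. length c = n}) \<le> 2 powr (\<alpha> * real n)" for n
        proof -
          \<comment> \<open>A clause of \<open>F\<close> may come from the list of another variable;
            \<open>B_closed\<close> moves it to the list of \<open>v\<close>.\<close>
          have "{c \<in> {c \<in> F. v \<in> vars c}. length c = n} \<subseteq> set (B v n)"
            using F(2) B_member B_closed by fastforce
          then have "card {c \<in> {c \<in> F. v \<in> vars c}. length c = n} \<le> card (set (B v n))"
            by (intro card_mono) auto
          also have "\<dots> \<le> card (clauses_with C v n)"
            unfolding setB by (intro card_image_le) (simp flip: L)
          finally show ?thesis using deg[rule_format, of v n] by linarith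
        qed
        have "1 / (2 * \<sigma>) * (1 + y) = 1 / (2 * \<sigma>\<^sup>2)" using \<sigma> by (simp add: y_def power2_eq_square)
        moreover have "(\<Sum>c\<in>{c \<in> F. v \<in> vars c}. (1 / (2 * \<sigma>\<^sup>2)) ^ length c) \<le> y"
        proof (rule branching_bound[OF \<sigma>(1) \<alpha> _ _ _ deg'])
          show "(2 powr \<alpha> / (2 * \<sigma>\<^sup>2)) ^ N \<le> y * (1 - 2 powr \<alpha> / (2 * \<sigma>\<^sup>2))"
            using N by (simp add: \<theta>_def)
          fix e assume "e \<in> {c \<in> F. v \<in> vars c}"
          then obtain i n where "e \<in> set (B i n)" using F(2) by blast
          then obtain c where "is_clause c" "Suc N \<le> clause_size c" "e = lits (clause_code c)"
            using mem by blast
          then show "N \<le> length e" using lits_clause_code(2)[of c] by simp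
        qed (use F(1) in simp)
        ultimately show "(\<Sum>c\<in>{c \<in> F. v \<in> vars c}. (1 / (2 * \<sigma>) * (1 + y)) ^ length c) \<le> y" by simp
      qed (use \<sigma> y in auto)
      then show "(\<Sum>w\<in>Words F h v. (1 / (2 * \<sigma>)) ^ weight w) \<le> 1" using y(2) by linarith
    qed (use q \<sigma> in auto)
    have "cmp (\<lambda>p. map clause_code (L (fst p) (snd p)))"
      by (rule cmp_code2[OF comp cmp_fst[OF cmp_id] cmp_snd[OF cmp_id]]) (simp add: enc_list_def enc_nat_def comp_def)
    then have "cmp (\<lambda>p. B (fst p) (snd p))"
      unfolding B_def by (intro cmp_map cmp_comp[OF cmp_lits] cmp_snd cmp_id)
    from cmp_assignment[OF this] have "computable_assignment assignment"
      by (simp add: cmp_def computable_assignment_def computable1_def enc_nat_def enc_bool_def)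
    moreover have "satisfies_cnf assignment C"
      unfolding satisfies_cnf_def
    proof
      fix j
      \<comment> \<open>The clause is nonempty, so one of its variables leads to a list
        \<open>B i n\<close> that contains it.\<close>
      have "card (clause_vars (C j)) > 0" using size[rule_format, of j] by (simp add: clause_size_def)
      then obtain i where "i \<in> clause_vars (C j)" by (auto simp: card_gt_0_iff)
      then have "lits (clause_code (C j)) \<in> set (B i (clause_size (C j)))"
        by (auto simp: setB clauses_with_def)
      from assignment_satisfies[OF this] show "satisfies_clause assignment (C j)"
        using lits_clause_code(1)[OF clause] by (force simp: satisfies_clause_def)
    qed
    ultimately show "\<exists>a. computable_assignment a \<and> satisfies_cnf a C" by blast
  qed
qed

end
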